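(* Let $K$ be a partition of $X$ parametrized by $(T,\mathcal A,\phi)$, let $d\in\mathcal D_{A,e}(X,\mathcal O)$ and let $\rho\in\mathcal D(X,\mathcal O)$. Then $d$ is quasisymmetric to $\rho$ (written $d\sim_{QS}\rho$) if and only if $\rho\in\mathcal D_{A,e}(X,\mathcal O)$ and $g_d$ is gentle with respect to $g_\rho$. Moreover, if $d$ is $M$-adapted (i.e. $M$-adapted to $g_d$) for an integer $M\ge 0$ and $d\sim_{QS}\rho$, then $\rho$ is $M$-adapted (i.e. $M$-adapted to $g_\rho$) as well.
   Context: Setting. $T$ is a countably infinite set, $\mathcal A:T\times T\to\{0,1\}$ is symmetric and vanishes on the diagonal, the graph on $T$ with edges $\{(w,v):\mathcal A(w,v)=1\}$ is a locally finite tree, and $\phi\in T$ is a fixed root. For $w\in T$: $|w|$ is the tree distance from $\phi$ to $w$; $(T)_m=\{w:|w|=m\}$; $\pi(w)$ is the neighbour of $w$ on the geodesic from $\phi$ to $w$ ($\pi(\phi)=\phi$); $S(w)$ is the set of neighbours of $w$ other than $\pi(w)$; $T_w$ is the set of $v\in T$ such that $w$ lies on the geodesic from $\phi$ to $v$. $\Sigma$ is the set of infinite geodesic rays $\omega=([\omega]_0=\phi,[\omega]_1,\ldots)$ of the tree starting at $\phi$. $(X,\mathcal O)$ is a compact metrizable topological space with no isolated point. A partition $K$ of $X$ parametrized by $(T,\mathcal A,\phi)$ assigns to each $w\in T$ a nonempty compact set $K_w\subseteq X$ such that $K_\phi=X$, $K_w=\bigcup_{v\in S(w)}K_v$ for all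 $w$, and $\bigcap_{m\ge0}K_{[\omega]_m}$ is a single point for every $\omega\in\Sigma$. Weight functions. A weight function is $g:T\to(0,1]$ with $g(\phi)=1$, $g(\pi(w))\ge g(w)$ for all $w$, and $\lim_{m\to\infty}\sup_{w\in(T)_m}g(w)=0$. For $s\in(0,1)$, $\Lambda^g_s=\{w\in T: g(\pi(w))>s\ge g(w)\}$; for $s\ge1$, $\Lambda^g_s=\{\phi\}$. For an integer $M\ge0$, $x\in X$, $s>0$, $U^g_M(x,s)$ is the set of $y\in X$ for which there are $w(1),\ldots,w(M+1)\in\Lambda^g_s$ with $x\in K_{w(1)}$, $y\in K_{w(M+1)}$ and $K_{w(i)}\cap K_{w(i+1)}\ne\emptyset$ for $1\le i\le M$. $g$ is exponential if there are $m\ge0$, $c_1\in(0,1)$ with $g(v)\le c_1g(w)$ whenever $v\in T_w$, $|v|\ge|w|+m$, and there is $c_2\in(0,1)$ with $g(v)\ge c_2g(w)$ whenever $v\in S(w)$. $f:T\to(0,\infty)$ is gentle with respect to a weight function $g$ if there is $c>0$ such that $f(v)\le c f(w)$ whenever $w,v\in\Lambda^g_s$ for some $s\in(0,1]$ and $K_w\cap K_v\neq\emptyset$. Metrics. $\mathcal D(X,\mathcal O)$ is the set of metrics $d$ on $X$ inducing $\mathcal O$ with $\operatorname{diam}(X,d)=1$; $B_d(x,r)=\{y:d(x,y)<r\}$; $g_d(w)=\operatorname{diam}(K_w,d)$. $d$ is $M$-adapted to $g$ if there are $\alpha_1,\alpha_2>0$ with $U^g_M(x,\alpha_1r)\subseteq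 B_d(x,r)\subseteq U^g_M(x,\alpha_2r)$ for all $x\in X$, $r>0$; $d$ is adapted if it is $M$-adapted to $g_d$ for some $M\ge0$. $\mathcal D_{A,e}(X,\mathcal O)$ is the set of $d\in\mathcal D(X,\mathcal O)$ that are adapted and for which $g_d$ is an exponential weight function. A metric $\rho$ is quasisymmetric to $d$ if there is a homeomorphism $h$ of $[0,\infty)$ onto itself with $h(0)=0$ such that for any $t>0$, $\rho(x,z)<h(t)\rho(x,y)$ whenever $d(x,z)<t\,d(x,y)$; this is an equivalence relation on $\mathcal D(X,\mathcal O)$. *)

theory Defs
  imports "HOL-Analysis.Analysis"
begin

section \<open>Rooted trees given by an adjacency matrix\<close>

text \<open>A path is the list of its vertices; a simple path has no repeated vertex.\<close>

definition simple_path :: "'t set \<Rightarrow> ('t \<Rightarrow> 't \<Rightarrow> nat) \<Rightarrow> 't \<Rightarrow> 't \<Rightarrow> 't list \<Rightarrow> bool" where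
  "simple_path T A w v p \<longleftrightarrow>
     p \<noteq> [] \<and> set p \<subseteq> T \<and> hd p = w \<and> last p = v \<and> distinct p \<and>
     successively (\<lambda>a b. A a b = 1) p"

text \<open>A tree is a graph in which any two vertices are joined by exactly one simple path, the
  geodesic between them. (For \<open>w = v\<close> the one-element list is always the only simple path.)\<close>

definition locally_finite_tree :: "'t set \<Rightarrow> ('t \<Rightarrow> 't \<Rightarrow> nat) \<Rightarrow> bool" where
  "locally_finite_tree T A \<longleftrightarrow>
     (\<forall>w\<in>T. \<forall>v\<in>T. A w v \<in> {0, 1}) \<and>
     (\<forall>w\<in>T. \<forall>v\<in>T. A w v = A v w) \<and>
     (\<forall>w\<in>T. A w w = 0) \<and>
     (\<forall>w\<in>T. finite {v \<in> T. A w v = 1}) \<and>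
     (\<forall>w\<in>T. \<forall>v\<in>T. \<exists>!p. simple_path T A w v p)"

definition geodesic :: "'t set \<Rightarrow> ('t \<Rightarrow> 't \<Rightarrow> nat) \<Rightarrow> 't \<Rightarrow> 't \<Rightarrow> 't list" where
  "geodesic T A w v = (THE p. simple_path T A w v p)"

definition height :: "'t set \<Rightarrow> ('t \<Rightarrow> 't \<Rightarrow> nat) \<Rightarrow> 't \<Rightarrow> 't \<Rightarrow> nat" where
  "height T A \<phi> w = length (geodesic T A \<phi> w) - 1"

definition level :: "'t set \<Rightarrow> ('t \<Rightarrow> 't \<Rightarrow> nat) \<Rightarrow> 't \<Rightarrow> nat \<Rightarrow> 't set" where
  "level T A \<phi> m = {w \<in> T. height T A \<phi> w = m}"

definition parent :: "'t set \<Rightarrow> ('t \<Rightarrow> 't \<Rightarrow> nat) \<Rightarrow> 't \<Rightarrow> 't \<Rightarrow> 't" where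
  "parent T A \<phi> w = (if w = \<phi> then \<phi> else last (butlast (geodesic T A \<phi> w)))"

definition children :: "'t set \<Rightarrow> ('t \<Rightarrow> 't \<Rightarrow> nat) \<Rightarrow> 't \<Rightarrow> 't \<Rightarrow> 't set" where
  "children T A \<phi> w = {v \<in> T. A w v = 1 \<and> v \<noteq> parent T A \<phi> w}"

definition descendants :: "'t set \<Rightarrow> ('t \<Rightarrow> 't \<Rightarrow> nat) \<Rightarrow> 't \<Rightarrow> 't \<Rightarrow> 't set" where
  "descendants T A \<phi> w = {v \<in> T. w \<in> set (geodesic T A \<phi> v)}"

text \<open>An infinite path is a geodesic ray if each of its initial segments is a geodesic.\<close>

definition rays :: "'t set \<Rightarrow> ('t \<Rightarrow> 't \<Rightarrow> nat) \<Rightarrow> 't \<Rightarrow> (nat \<Rightarrow> 't) set" where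
  "rays T A \<phi> = {\<omega>. \<omega> 0 = \<phi> \<and>
     (\<forall>n. \<omega> n \<in> T \<and> geodesic T A \<phi> (\<omega> n) = map \<omega> [0..<Suc n])}"

section \<open>Partitions and weight functions\<close>

definition partition_of ::
    "'x topology \<Rightarrow> 't set \<Rightarrow> ('t \<Rightarrow> 't \<Rightarrow> nat) \<Rightarrow> 't \<Rightarrow> ('t \<Rightarrow> 'x set) \<Rightarrow> bool" where
  "partition_of X T A \<phi> K \<longleftrightarrow>
     (\<forall>w\<in>T. K w \<noteq> {} \<and> compactin X (K w)) \<and>
     K \<phi> = topspace X \<and>
     (\<forall>w\<in>T. K w = (\<Union>v\<in>children T A \<phi> w. K v)) \<and>
     (\<forall>\<omega>\<in>rays T A \<phi>. \<exists>x. (\<Inter>m. K (\<omega> m)) = {x})"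

text \<open>Here and below, only the values of \<open>g\<close> and \<open>K\<close> on \<open>T\<close> matter. The levels of an infinite,
  locally finite tree are finite and nonempty, so the supremum is a genuine one.\<close>

definition weight_function ::
    "'t set \<Rightarrow> ('t \<Rightarrow> 't \<Rightarrow> nat) \<Rightarrow> 't \<Rightarrow> ('t \<Rightarrow> real) \<Rightarrow> bool" where
  "weight_function T A \<phi> g \<longleftrightarrow>
     (\<forall>w\<in>T. 0 < g w \<and> g w \<le> 1) \<and>
     g \<phi> = 1 \<and>
     (\<forall>w\<in>T. g w \<le> g (parent T A \<phi> w)) \<and>
     (\<lambda>m. SUP w\<in>level T A \<phi> m. g w) \<longlonglongrightarrow> 0"

definition scale ::
    "'t set \<Rightarrow> ('t \<Rightarrow> 't \<Rightarrow> nat) \<Rightarrow> 't \<Rightarrow> ('t \<Rightarrow> real) \<Rightarrow> real \<Rightarrow> 't set" where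
  "scale T A \<phi> g s =
     (if s \<ge> 1 then {\<phi>} else {w \<in> T. g (parent T A \<phi> w) > s \<and> s \<ge> g w})"

definition chain_nbhd ::
    "'t set \<Rightarrow> ('t \<Rightarrow> 't \<Rightarrow> nat) \<Rightarrow> 't \<Rightarrow> ('t \<Rightarrow> 'x set) \<Rightarrow> ('t \<Rightarrow> real) \<Rightarrow> nat \<Rightarrow> 'x \<Rightarrow> real \<Rightarrow> 'x set"
  where
  "chain_nbhd T A \<phi> K g M x s =
     {y. \<exists>w :: nat \<Rightarrow> 't. (\<forall>i\<in>{1..M+1}. w i \<in> scale T A \<phi> g s) \<and>
           x \<in> K (w 1) \<and> y \<in> K (w (M+1)) \<and>
           (\<forall>i\<in>{1..M}. K (w i) \<inter> K (w (i+1)) \<noteq> {})}"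

definition exponential ::
    "'t set \<Rightarrow> ('t \<Rightarrow> 't \<Rightarrow> nat) \<Rightarrow> 't \<Rightarrow> ('t \<Rightarrow> real) \<Rightarrow> bool" where
  "exponential T A \<phi> g \<longleftrightarrow>
     (\<exists>m::nat. \<exists>c\<^sub>1\<in>{0<..<1}. \<forall>w\<in>T. \<forall>v\<in>descendants T A \<phi> w.
        height T A \<phi> v \<ge> height T A \<phi> w + m \<longrightarrow> g v \<le> c\<^sub>1 * g w) \<and>
     (\<exists>c\<^sub>2\<in>{0<..<1}. \<forall>w\<in>T. \<forall>v\<in>children T A \<phi> w. g v \<ge> c\<^sub>2 * g w)"

definition gentle_wrt ::
    "'t set \<Rightarrow> ('t \<Rightarrow> 't \<Rightarrow> nat) \<Rightarrow> 't \<Rightarrow> ('t \<Rightarrow> 'x set) \<Rightarrow> ('t \<Rightarrow> real) \<Rightarrow> ('t \<Rightarrow> real) \<Rightarrow> bool"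
  where
  "gentle_wrt T A \<phi> K f g \<longleftrightarrow>
     weight_function T A \<phi> g \<and> (\<forall>w\<in>T. 0 < f w) \<and>
     (\<exists>c>0. \<forall>s\<in>{0<..1}. \<forall>w\<in>scale T A \<phi> g s. \<forall>v\<in>scale T A \<phi> g s.
        K w \<inter> K v \<noteq> {} \<longrightarrow> f v \<le> c * f w)"

section \<open>Metrics\<close>

text \<open>Only used for nonempty sets that are bounded with respect to \<open>d\<close>.\<close>

definition mdiam :: "('x \<Rightarrow> 'x \<Rightarrow> real) \<Rightarrow> 'x set \<Rightarrow> real" where
  "mdiam d S = (SUP (x, y)\<in>S \<times> S. d x y)"

definition metrics :: "'x topology \<Rightarrow> ('x \<Rightarrow> 'x \<Rightarrow> real) set" where
  "metrics X = {d. Metric_space (topspace X) d \<and>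
     Metric_space.mtopology (topspace X) d = X \<and> mdiam d (topspace X) = 1}"

definition diam_weight :: "('t \<Rightarrow> 'x set) \<Rightarrow> ('x \<Rightarrow> 'x \<Rightarrow> real) \<Rightarrow> 't \<Rightarrow> real" where
  "diam_weight K d w = mdiam d (K w)"

definition M_adapted_to ::
    "'x topology \<Rightarrow> 't set \<Rightarrow> ('t \<Rightarrow> 't \<Rightarrow> nat) \<Rightarrow> 't \<Rightarrow> ('t \<Rightarrow> 'x set) \<Rightarrow> nat \<Rightarrow>
      ('x \<Rightarrow> 'x \<Rightarrow> real) \<Rightarrow> ('t \<Rightarrow> real) \<Rightarrow> bool" where
  "M_adapted_to X T A \<phi> K M d g \<longleftrightarrow>
     (\<exists>\<alpha>\<^sub>1>0. \<exists>\<alpha>\<^sub>2>0. \<forall>x\<in>topspace X. \<forall>r>0.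
        chain_nbhd T A \<phi> K g M x (\<alpha>\<^sub>1 * r) \<subseteq> Metric_space.mball (topspace X) d x r \<and>
        Metric_space.mball (topspace X) d x r \<subseteq> chain_nbhd T A \<phi> K g M x (\<alpha>\<^sub>2 * r))"

definition adapted ::
    "'x topology \<Rightarrow> 't set \<Rightarrow> ('t \<Rightarrow> 't \<Rightarrow> nat) \<Rightarrow> 't \<Rightarrow> ('t \<Rightarrow> 'x set) \<Rightarrow>
      ('x \<Rightarrow> 'x \<Rightarrow> real) \<Rightarrow> bool" where
  "adapted X T A \<phi> K d \<longleftrightarrow> (\<exists>M. M_adapted_to X T A \<phi> K M d (diam_weight K d))"

definition metrics_Ae ::
    "'x topology \<Rightarrow> 't set \<Rightarrow> ('t \<Rightarrow> 't \<Rightarrow> nat) \<Rightarrow> 't \<Rightarrow> ('t \<Rightarrow> 'x set) \<Rightarrow>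
      ('x \<Rightarrow> 'x \<Rightarrow> real) set" where
  "metrics_Ae X T A \<phi> K = {d \<in> metrics X. adapted X T A \<phi> K d \<and>
     weight_function T A \<phi> (diam_weight K d) \<and> exponential T A \<phi> (diam_weight K d)}"

text \<open>\<open>quasisymmetric_to X \<rho> d\<close>: the metric \<open>\<rho>\<close> is quasisymmetric to the metric \<open>d\<close>.\<close>

definition quasisymmetric_to ::
    "'x topology \<Rightarrow> ('x \<Rightarrow> 'x \<Rightarrow> real) \<Rightarrow> ('x \<Rightarrow> 'x \<Rightarrow> real) \<Rightarrow> bool" where
  "quasisymmetric_to X \<rho> d \<longleftrightarrow>
     (\<exists>h :: real \<Rightarrow> real.
        homeomorphic_map (top_of_set {0..}) (top_of_set {0..}) h \<and> h 0 = 0 \<and>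
        (\<forall>t>0. \<forall>x\<in>topspace X. \<forall>y\<in>topspace X. \<forall>z\<in>topspace X.
           d x z < t * d x y \<longrightarrow> \<rho> x z < h t * \<rho> x y))"

end

theory Submission
  imports Defs
begin

text \<open>If \<open>d\<close> and \<open>\<rho>\<close> are quasisymmetric, then comparing the diameters of two meeting cells through a
  common point and a farthest point transfers the weight, exponentiality, gentleness and
  adaptedness conditions from \<open>d\<close> to \<open>\<rho>\<close>.
  Conversely, fix a descending sequence of cells at \<open>x\<close> and let \<open>w\<close> and \<open>u\<close> be its members in the
  scales of \<open>g\<^sub>\<rho>\<close> comparable to \<open>\<rho> x y\<close> and to \<open>t * \<rho> x y > \<rho> x z\<close>. Gentleness and adaptedness give
  \<open>d x y \<ge> \<delta> * g\<^sub>d w\<close> and \<open>d x z \<le> B * g\<^sub>d u\<close>. Along the sequence both \<open>g\<^sub>d\<close> and \<open>g\<^sub>\<rho>\<close> decay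
  exponentially in the height, so \<open>g\<^sub>d u / g\<^sub>d w\<close> is bounded by a multiple of
  \<open>t powr p + t powr q\<close>.\<close>

section \<open>Rooted trees\<close>

text \<open>Diameters of two cells can be compared only through a common point, so all estimates
  stay among meeting cells. The integer \<open>M\<close> survives the change of metric because a
  chain for \<open>d\<close> is turned into one for \<open>\<rho>\<close> by replacing each cell
  with an ancestor, which leaves the number of cells unchanged. In the converse the obstacle is that
  the cells produced by adaptedness of \<open>d\<close> and of \<open>\<rho>\<close> need not be
  related in the tree. A single descending sequence through \<open>x\<close> repairs this: its
  members are ancestors and descendants of each other, and gentleness moves any other cell of the
  same scale along a chain onto them at the price of a constant factor. Whether \<open>u\<close>
  lies below or above \<open>w\<close> depends on \<open>t\<close>. The exponent \<open>p\<close>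
  belongs to the first case and \<open>q\<close> to the second; adding the two powers covers both
  and gives an explicit homeomorphism of the half-line.\<close>

locale rooted_tree =
  fixes T :: "'t set" and A :: "'t \<Rightarrow> 't \<Rightarrow> nat" and \<phi> :: 't
  assumes tree: "locally_finite_tree T A" and root: "\<phi> \<in> T"
begin

abbreviation "geo \<equiv> geodesic T A \<phi>"
abbreviation "par \<equiv> parent T A \<phi>"
abbreviation "chl \<equiv> children T A \<phi>"
abbreviation "ht \<equiv> height T A \<phi>"
abbreviation "desc \<equiv> descendants T A \<phi>"

lemma simple_path_geo: "w \<in> T \<Longrightarrow> simple_path T A \<phi> w (geo w)"
  using tree root unfolding locally_finite_tree_def geodesic_def
  by (metis (mono_tags, lifting) theI')

lemma geo_unique: "simple_path T A \<phi> w p \<Longrightarrow> geo w = p"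
proof -
  assume p: "simple_path T A \<phi> w p"
  then have "w \<in> T" unfolding simple_path_def by (metis last_in_set subsetD)
  with p tree root show ?thesis
    unfolding locally_finite_tree_def using simple_path_geo by blast
qed

lemma geo_root: "geo \<phi> = [\<phi>]"
  by (rule geo_unique) (simp add: simple_path_def root)

lemma par_root [simp]: "par \<phi> = \<phi>"
  by (simp add: parent_def)

lemma ht_root [simp]: "ht \<phi> = 0"
  by (simp add: height_def geo_root)

lemma geo_snoc:
  assumes "v \<in> T" "v \<noteq> \<phi>"
  shows "par v \<in> T" "geo v = geo (par v) @ [v]" "A (par v) v = 1"
proof -
  let ?p = "geo v"
  have sp: "simple_path T A \<phi> v ?p" using assms simple_path_geo by blast
  define q where "q = butlast ?p"
  have p: "?p = q @ [v]"
    using sp unfolding q_def simple_path_def by (metis append_butlast_last_id)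
  have qn: "q \<noteq> []" using sp assms p unfolding simple_path_def by auto
  have pq: "par v = last q" using assms by (simp add: parent_def q_def)
  show "par v \<in> T" using sp p qn pq unfolding simple_path_def by auto
  have "simple_path T A \<phi> (par v) q"
    using sp qn unfolding pq p simple_path_def by (auto simp: successively_append_iff)
  then have "geo (par v) = q" by (rule geo_unique)
  then show "?p = geo (par v) @ [v]" using p by simp
  show "A (par v) v = 1" using sp qn unfolding pq p simple_path_def by (auto simp: successively_append_iff)
qed

lemma par_closed: "w \<in> T \<Longrightarrow> par w \<in> T"
  using geo_snoc(1) root by (cases "w = \<phi>") auto

lemma geo_nonempty: "w \<in> T \<Longrightarrow> geo w \<noteq> []"
  using simple_path_geo simple_path_def by metis

lemma ht_par: "v \<in> T \<Longrightarrow> v \<noteq> \<phi> \<Longrightarrow> ht v = Suc (ht (par v))"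
  using geo_snoc[of v] geo_nonempty[of "par v"] unfolding height_def by simp

text \<open>If a neighbour \<open>v\<close> of \<open>w\<close> lay on the geodesic to
  \<open>w\<close>, cutting there and stepping directly to \<open>w\<close> would give another
  simple path, so by uniqueness \<open>v\<close> would be the parent. Hence \<open>v\<close> is off
  the geodesic, and appending it yields the geodesic to \<open>v\<close>. Conversely, heights
  exclude that a vertex is the parent of its own parent.\<close>

lemma chl_iff:
  assumes w: "w \<in> T"
  shows "v \<in> chl w \<longleftrightarrow> v \<in> T \<and> v \<noteq> \<phi> \<and> par v = w"
proof
  assume "v \<in> chl w"
  then have v: "v \<in> T" "A w v = 1" "v \<noteq> par w" by (auto simp: children_def)
  have sp: "simple_path T A \<phi> w (geo w)" using simple_path_geo w by blast
  have vw: "v \<noteq> w" using v w tree unfolding locally_finite_tree_def by auto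
  have "v \<notin> set (geo w)"
  proof
    assume "v \<in> set (geo w)"
    then obtain p1 p2 where p: "geo w = p1 @ v # p2" by (meson split_list)
    then have "p2 \<noteq> []" using sp vw unfolding simple_path_def by auto
    then have w2: "w \<in> set p2" using sp p unfolding simple_path_def by auto
    have "A v w = 1" using v w tree unfolding locally_finite_tree_def by auto
    then have "simple_path T A \<phi> w (p1 @ [v, w])"
      using sp w2 w unfolding p simple_path_def
      by (auto simp: successively_append_iff hd_append split: if_splits)
    then have pw: "geo w = p1 @ [v, w]" by (rule geo_unique)
    have "w \<noteq> \<phi>" using pw geo_root by auto
    then have "par w = v" using pw by (simp add: parent_def butlast_append)
    then show False using v by simp
  qed
  then have "simple_path T A \<phi> v (geo w @ [v])"
    using sp v unfolding simple_path_def by (auto simp: successively_append_iff)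
  then have g: "geo v = geo w @ [v]" by (rule geo_unique)
  have ne: "geo w \<noteq> []" using sp unfolding simple_path_def by simp
  have vr: "v \<noteq> \<phi>" using g geo_root ne by auto
  then have "par v = w" using g sp unfolding simple_path_def by (simp add: parent_def)
  then show "v \<in> T \<and> v \<noteq> \<phi> \<and> par v = w" using v vr by simp
next
  assume v: "v \<in> T \<and> v \<noteq> \<phi> \<and> par v = w"
  have "v \<noteq> par w"
  proof
    assume vp: "v = par w"
    then have "w \<noteq> \<phi>" using v by auto
    then have "ht w = Suc (ht v)" using vp ht_par w by simp
    moreover have "ht v = Suc (ht w)" using v ht_par by simp
    ultimately show False by simp
  qed
  then show "v \<in> chl w" using v geo_snoc(3)[of v] by (auto simp: children_def)
qed

lemma desc_root: "desc w \<inter> {\<phi>} \<subseteq> {w}"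
  unfolding descendants_def by (auto simp: geo_root)

lemma desc_iff:
  assumes "v \<in> T"
  shows "v \<in> desc w \<longleftrightarrow> v = w \<or> v \<noteq> \<phi> \<and> par v \<in> desc w"
proof (cases "v = \<phi>")
  case True
  then show ?thesis using root by (auto simp: descendants_def geo_root)
next
  case False
  then show ?thesis using assms geo_snoc(1,2)[of v] by (auto simp: descendants_def)
qed

lemma desc_refl: "w \<in> T \<Longrightarrow> w \<in> desc w"
  using desc_iff by blast

lemma desc_child: "u \<in> T \<Longrightarrow> v \<in> chl u \<Longrightarrow> u \<in> desc w \<Longrightarrow> v \<in> desc w"
  using desc_iff[of v w] chl_iff[of u v] by auto

lemma desc_in: "v \<in> desc w \<Longrightarrow> v \<in> T"
  by (simp add: descendants_def)

text \<open>Every property compared between a vertex and a descendant is propagated one edge at a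
  time; the underlying induction is on the height of \<open>v\<close>.\<close>

lemma desc_induct [consumes 2, case_names refl step]:
  assumes "v \<in> desc w" "w \<in> T" "P w"
    and step: "\<And>v. v \<in> T \<Longrightarrow> v \<noteq> \<phi> \<Longrightarrow> par v \<in> desc w \<Longrightarrow> P (par v) \<Longrightarrow> P v"
  shows "P v"
  using assms(1)
proof (induction "ht v" arbitrary: v)
  case 0
  then have "v = \<phi>" using ht_par[of v] desc_in by fastforce
  then show ?case using 0 assms(3) desc_root by auto
next
  case (Suc n)
  show ?case
  proof (cases "v = w")
    case False
    then have "v \<noteq> \<phi>" "par v \<in> desc w" using Suc(3) desc_iff desc_in by blast+
    then show ?thesis using Suc step[of v] ht_par[of v] desc_in by auto
  qed (use assms in simp)
qed

lemma desc_ht: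
  assumes "v \<in> desc w" "w \<in> T"
  shows "ht w \<le> ht v"
  using assms by (induction rule: desc_induct) (auto simp: ht_par)

text \<open>Supplies the intermediate vertices needed to iterate a decay estimate that holds over a
  fixed number of levels.\<close>

lemma desc_between:
  assumes "v \<in> desc w" "w \<in> T" "ht w \<le> n" "n \<le> ht v"
  shows "\<exists>u. u \<in> desc w \<and> v \<in> desc u \<and> ht u = n"
  using assms
proof (induction rule: desc_induct)
  case refl
  then show ?case using desc_refl assms(2) by (metis le_antisym)
next
  case (step v)
  have v: "v \<in> desc w" using step desc_iff by blast
  show ?case
  proof (cases "n = ht v")
    case True
    then show ?thesis using v step desc_refl by blast
  next
    case False
    then have "n \<le> ht (par v)" using step ht_par[of v] by auto
    then show ?thesis using step desc_iff by metis
  qed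
qed

end

section \<open>Exponents relating two geometric rates of decay\<close>

lemma power_base_change:
  fixes c e :: real
  assumes "0 < c" "c < 1" "0 < e" "e < 1"
  obtains p where "0 < p" "c = e powr p"
proof (rule that)
  show "0 < ln c / ln e" using assms by (simp add: divide_neg_neg)
  show "c = e powr (ln c / ln e)" using assms by (simp add: powr_def)
qed

lemma power_powr_swap: "0 < e \<Longrightarrow> (e ^ n) powr p = (e powr p) ^ n" for e p :: real
  by (simp add: powr_realpow[symmetric] powr_powr mult.commute)

section \<open>Cells and weight functions\<close>

locale partitioned_tree = rooted_tree T A \<phi>
  for T :: "'t set" and A :: "'t \<Rightarrow> 't \<Rightarrow> nat" and \<phi> :: 't +
  fixes X :: "'x topology" and K :: "'t \<Rightarrow> 'x set"
  assumes partition: "partition_of X T A \<phi> K"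
begin

abbreviation "weight \<equiv> weight_function T A \<phi>"
abbreviation "sc \<equiv> scale T A \<phi>"
abbreviation "expo \<equiv> exponential T A \<phi>"

lemma cell_nonempty: "w \<in> T \<Longrightarrow> K w \<noteq> {}"
  and cell_subset: "w \<in> T \<Longrightarrow> K w \<subseteq> topspace X"
  and cell_root: "K \<phi> = topspace X"
  and cell_children: "w \<in> T \<Longrightarrow> K w = (\<Union>v\<in>chl w. K v)"
proof -
  note P = partition[unfolded partition_of_def]
  show "w \<in> T \<Longrightarrow> K w \<noteq> {}" "w \<in> T \<Longrightarrow> K w \<subseteq> topspace X" using P compactin_subset_topspace by metis+
  show "K \<phi> = topspace X" using P by (elim conjE)
  show "w \<in> T \<Longrightarrow> K w = (\<Union>v\<in>chl w. K v)" using P by (elim conjE) (rule bspec)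
qed

lemma cell_child_subset: "w \<in> T \<Longrightarrow> v \<in> chl w \<Longrightarrow> K v \<subseteq> K w"
  by (subst cell_children[of w]) auto

lemma cell_child_exists: "w \<in> T \<Longrightarrow> x \<in> K w \<Longrightarrow> \<exists>v. v \<in> chl w \<and> x \<in> K v"
  by (subst (asm) cell_children[of w]) auto

lemma cell_mono:
  assumes "v \<in> desc w" "w \<in> T"
  shows "K v \<subseteq> K w"
  using assms
proof (induction rule: desc_induct)
  case (step v)
  then have "v \<in> chl (par v)" using chl_iff par_closed by blast
  then have "K v \<subseteq> K (par v)" using cell_child_subset par_closed step by blast
  then show ?case using step by simp
qed simp

section \<open>Monotonicity and decay of weight functions\<close>

lemma weight_pos: "weight g \<Longrightarrow> w \<in> T \<Longrightarrow> 0 < g w"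
  and weight_le_1: "weight g \<Longrightarrow> w \<in> T \<Longrightarrow> g w \<le> 1"
  and weight_root: "weight g \<Longrightarrow> g \<phi> = 1"
  and weight_par: "weight g \<Longrightarrow> w \<in> T \<Longrightarrow> g w \<le> g (par w)"
  unfolding weight_function_def by blast+

lemma weight_desc:
  assumes "v \<in> desc w" "w \<in> T" "weight g"
  shows "g v \<le> g w"
  using assms
proof (induction rule: desc_induct)
  case (step v)
  then show ?case using weight_par[of g v] by simp
qed simp

lemma weight_eventually_small:
  assumes g: "weight g" and s: "0 < s"
  shows "\<exists>N. \<forall>w\<in>T. N \<le> ht w \<longrightarrow> g w < s"
proof -
  have "(\<lambda>m. SUP w\<in>level T A \<phi> m. g w) \<longlonglongrightarrow> 0"
    using g unfolding weight_function_def by blast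
  then have "\<forall>\<^sub>F m in sequentially. (SUP w\<in>level T A \<phi> m. g w) < s"
    using s by (rule order_tendstoD(2))
  then obtain N where N: "\<And>m. N \<le> m \<Longrightarrow> (SUP w\<in>level T A \<phi> m. g w) < s"
    unfolding eventually_sequentially by blast
  have "g w < s" if w: "w \<in> T" "N \<le> ht w" for w
  proof -
    have "bdd_above (g ` level T A \<phi> (ht w))"
      by (rule bdd_aboveI2[of _ _ 1]) (use weight_le_1[OF g] in \<open>auto simp: level_def\<close>)
    then have "g w \<le> (SUP w\<in>level T A \<phi> (ht w). g w)"
      using w by (intro cSUP_upper) (auto simp: level_def)
    then show ?thesis using N[OF w(2)] by simp
  qed
  then show ?thesis by blast
qed

section \<open>Descending sequences of cells through a point, and their members in a scale\<close>

definition cell_ray :: "'x \<Rightarrow> (nat \<Rightarrow> 't) \<Rightarrow> bool" where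
  "cell_ray x \<omega> \<longleftrightarrow> (\<forall>n. \<omega> n \<in> T \<and> x \<in> K (\<omega> n) \<and> \<omega> (Suc n) \<in> chl (\<omega> n))"

lemma cell_ray_exists:
  assumes "w \<in> T" "x \<in> K w"
  obtains \<omega> where "cell_ray x \<omega>" "\<omega> 0 = w"
proof -
  have "\<exists>v. (v \<in> T \<and> x \<in> K v) \<and> v \<in> chl u" if "u \<in> T \<and> x \<in> K u" for u
    using that cell_child_exists[of u x] chl_iff[of u] by auto
  then have "\<exists>\<omega>. \<forall>n. ((\<omega> n \<in> T \<and> x \<in> K (\<omega> n)) \<and> (n = 0 \<longrightarrow> \<omega> n = w)) \<and> \<omega> (Suc n) \<in> chl (\<omega> n)"
    using assms by (intro dependent_nat_choice) auto
  then obtain \<omega> where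
    "\<forall>n. ((\<omega> n \<in> T \<and> x \<in> K (\<omega> n)) \<and> (n = 0 \<longrightarrow> \<omega> n = w)) \<and> \<omega> (Suc n) \<in> chl (\<omega> n)" ..
  then show thesis by (intro that[of \<omega>]) (simp_all add: cell_ray_def)
qed

lemma cell_ray_desc:
  assumes "cell_ray x \<omega>"
  shows "\<omega> (i + n) \<in> desc (\<omega> i)" "ht (\<omega> (i + n)) = ht (\<omega> i) + n"
proof -
  have "\<omega> (i + n) \<in> desc (\<omega> i) \<and> ht (\<omega> (i + n)) = ht (\<omega> i) + n"
  proof (induction n)
    case 0
    then show ?case using assms desc_refl by (simp add: cell_ray_def)
  next
    case (Suc n)
    have c: "\<omega> (i + n) \<in> T" "\<omega> (i + Suc n) \<in> chl (\<omega> (i + n))"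
      using assms by (simp_all add: cell_ray_def)
    then have "par (\<omega> (i + Suc n)) = \<omega> (i + n)" "\<omega> (i + Suc n) \<in> T" "\<omega> (i + Suc n) \<noteq> \<phi>"
      using chl_iff by auto
    then show ?case using Suc desc_child c ht_par[of "\<omega> (i + Suc n)"] by auto
  qed
  then show "\<omega> (i + n) \<in> desc (\<omega> i)" "ht (\<omega> (i + n)) = ht (\<omega> i) + n" by auto
qed

lemma scale_in: "w \<in> sc g s \<Longrightarrow> w \<in> T"
  using root by (auto simp: scale_def split: if_splits)

lemma scale_le: "weight g \<Longrightarrow> w \<in> sc g s \<Longrightarrow> g w \<le> s"
  using weight_root[of g] by (auto simp: scale_def split: if_splits)

text \<open>The first member whose weight is at most \<open>s\<close> works: such a member exists
  because weights tend to 0, and it has a predecessor in the sequence because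
  \<open>s < g (\<omega> 0)\<close>. That predecessor is its parent and still has weight above
  \<open>s\<close>.\<close>

lemma cell_ray_scale:
  assumes g: "weight g" and r: "cell_ray x \<omega>" and s: "0 < s" "s < g (\<omega> 0)"
  obtains n where "\<omega> n \<in> sc g s"
proof -
  have T: "\<omega> n \<in> T" for n using r by (simp add: cell_ray_def)
  obtain N where N: "\<forall>w\<in>T. N \<le> ht w \<longrightarrow> g w < s" using weight_eventually_small[OF g s(1)] by blast
  have "g (\<omega> N) \<le> s" using N T cell_ray_desc(2)[OF r, of 0 N] by (auto simp: less_imp_le)
  then obtain n where n: "g (\<omega> n) \<le> s" "\<And>k. k < n \<Longrightarrow> \<not> g (\<omega> k) \<le> s"
    using exists_least_iff[of "\<lambda>n. g (\<omega> n) \<le> s"] by blast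
  then obtain k where k: "n = Suc k" using s by (cases n) auto
  have "\<omega> n \<in> chl (\<omega> k)" using r k by (simp add: cell_ray_def)
  then have "par (\<omega> n) = \<omega> k" using chl_iff T by blast
  moreover have "s < 1" using s weight_le_1[OF g T, of 0] by simp
  ultimately have "\<omega> n \<in> sc g s" using n k T by (auto simp: scale_def not_le)
  then show thesis using that by blast
qed

lemma cell_ray_scale_root:
  assumes g: "weight g" and r: "cell_ray x \<omega>" and s: "0 < s" "\<omega> 0 = \<phi>"
  obtains n where "\<omega> n \<in> sc g s"
proof (cases "s < 1")
  case True
  then have s0: "s < g (\<omega> 0)" using s weight_root[OF g] by simp
  show thesis by (rule cell_ray_scale[OF g r s(1) s0]) (rule that)
next
  case False
  then have "\<omega> 0 \<in> sc g s" using s by (simp add: scale_def)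
  then show thesis using that by blast
qed

lemma scale_below:
  assumes g: "weight g" and w: "w \<in> T" "x \<in> K w" and s: "0 < s" "s < g w"
  obtains v where "v \<in> sc g s" "v \<in> desc w" "x \<in> K v"
proof -
  obtain \<omega> where r: "cell_ray x \<omega>" "\<omega> 0 = w" by (rule cell_ray_exists[OF w])
  then have s0: "s < g (\<omega> 0)" using s by simp
  obtain n where n: "\<omega> n \<in> sc g s" by (rule cell_ray_scale[OF g r(1) s(1) s0])
  have "\<omega> n \<in> desc w" using cell_ray_desc(1)[OF r(1), of 0 n] r by simp
  moreover have "x \<in> K (\<omega> n)" using r(1) by (simp add: cell_ray_def)
  ultimately show thesis using that n by blast
qed

text \<open>Climb from \<open>w\<close> until the parent has weight above \<open>s\<close>. For
  \<open>s < 1\<close> this happens before the root is passed, since the root has weight 1; for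
  larger \<open>s\<close> the root itself is the scale.\<close>

lemma scale_above:
  assumes g: "weight g" and w: "w \<in> T" and s: "0 < s" "g w \<le> s"
  obtains u where "u \<in> sc g s" "w \<in> desc u"
proof -
  have "\<exists>u. u \<in> sc g s \<and> w \<in> desc u"
  proof (cases "s < 1")
    case False
    have "geo w \<noteq> []" "hd (geo w) = \<phi>" using simple_path_geo[OF w] by (simp_all add: simple_path_def)
    then have "\<phi> \<in> set (geo w)" using hd_in_set[of "geo w"] by simp
    then have "w \<in> desc \<phi>" using w by (simp add: descendants_def)
    moreover have "\<phi> \<in> sc g s" using False by (simp add: scale_def)
    ultimately show ?thesis by blast
  next
    case True
    show ?thesis using w s(2)
    proof (induction "ht w" arbitrary: w rule: less_induct)
      case less
      have nr: "w \<noteq> \<phi>" using less(3) True weight_root[OF g] by auto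
      show ?case
      proof (cases "s < g (par w)")
        case True
        then have "w \<in> sc g s" using less(2,3) \<open>s < 1\<close> by (simp add: scale_def)
        then show ?thesis using desc_refl[OF less(2)] by blast
      next
        case False
        then obtain u where "u \<in> sc g s" "par w \<in> desc u"
          using less(1)[of "par w"] ht_par[of w] nr less(2) par_closed by auto
        moreover from this nr have "w \<in> desc u" using desc_iff[OF less(2), of u] by simp
        ultimately show ?thesis by blast
      qed
    qed
  qed
  then show thesis using that by blast
qed

text \<open>Extends gentleness, which is stated for scales in (0,1], to every positive
  scale.\<close>

lemma scale_min: "sc g (min s 1) = sc g s"
  by (auto simp: scale_def min_def)

text \<open>Chains are indexed from 0 to \<open>M\<close> here and in the elimination rule, so that
  inductions along a chain start at the cell containing \<open>x\<close>.\<close>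

lemma chain_nbhdI:
  assumes "\<And>i. i \<le> M \<Longrightarrow> w i \<in> sc g s" "x \<in> K (w 0)" "y \<in> K (w M)"
    "\<And>i. i < M \<Longrightarrow> K (w i) \<inter> K (w (Suc i)) \<noteq> {}"
  shows "y \<in> chain_nbhd T A \<phi> K g M x s"
proof -
  have "K (w (i - 1)) \<inter> K (w (i + 1 - 1)) \<noteq> {}" if "i \<in> {1..M}" for i
  proof -
    have "i - 1 < M" and eq: "Suc (i - 1) = i + 1 - 1" using that by auto
    from assms(4)[OF this(1)] show ?thesis unfolding eq .
  qed
  then have "\<forall>i\<in>{1..M}. K (w (i - 1)) \<inter> K (w (i + 1 - 1)) \<noteq> {}" by blast
  moreover have "\<forall>i\<in>{1..M+1}. w (i - 1) \<in> sc g s" by (intro ballI assms(1)) auto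
  moreover have "x \<in> K (w (1 - 1))" "y \<in> K (w (M + 1 - 1))" using assms(2,3) by simp_all
  ultimately show ?thesis unfolding chain_nbhd_def mem_Collect_eq
    by (intro exI[of _ "\<lambda>i. w (i - 1)"] conjI)
qed

lemma chain_nbhdE:
  assumes "y \<in> chain_nbhd T A \<phi> K g M x s"
  obtains w where "\<And>i. i \<le> M \<Longrightarrow> w i \<in> sc g s" "x \<in> K (w 0)" "y \<in> K (w M)"
    "\<And>i. i < M \<Longrightarrow> K (w i) \<inter> K (w (Suc i)) \<noteq> {}"
proof -
  obtain w where w: "\<forall>i\<in>{1..M+1}. w i \<in> sc g s" "x \<in> K (w 1)" "y \<in> K (w (M+1))"
    "\<forall>i\<in>{1..M}. K (w i) \<inter> K (w (i+1)) \<noteq> {}"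
    using assms unfolding chain_nbhd_def by blast
  show thesis
  proof (rule that[of "\<lambda>i. w (Suc i)"])
    show "K (w (Suc i)) \<inter> K (w (Suc (Suc i))) \<noteq> {}" if "i < M" for i
      using bspec[OF w(4), of "Suc i"] that by simp
  qed (use w(1-3) in simp_all)
qed

text \<open>A chain of small cells can be coarsened to a chain in the scale by passing to ancestors.\<close>

lemma chain_nbhd_of_small:
  assumes g: "weight g" and s: "0 < s"
    and w: "\<And>i. i \<le> M \<Longrightarrow> w i \<in> T" "\<And>i. i \<le> M \<Longrightarrow> g (w i) \<le> s"
    and xy: "x \<in> K (w 0)" "y \<in> K (w M)"
    and meet: "\<And>i. i < M \<Longrightarrow> K (w i) \<inter> K (w (Suc i)) \<noteq> {}"
  shows "y \<in> chain_nbhd T A \<phi> K g M x s"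
proof -
  have "\<exists>u. u \<in> sc g s \<and> K (w i) \<subseteq> K u" if "i \<le> M" for i
    by (rule scale_above[OF g w(1)[OF that] s w(2)[OF that]]) (use cell_mono scale_in in blast)
  then obtain u where u: "\<And>i. i \<le> M \<Longrightarrow> u i \<in> sc g s \<and> K (w i) \<subseteq> K (u i)" by metis
  show ?thesis
  proof (rule chain_nbhdI)
    show "K (u i) \<inter> K (u (Suc i)) \<noteq> {}" if "i < M" for i
      using u[of i] u[of "Suc i"] meet[OF that] that by auto
  qed (use u[of 0] u[of M] u xy in auto)
qed

section \<open>Exponential weight functions\<close>

text \<open>The decay over \<open>m\<close> levels is iterated \<open>k\<close> times through
  intermediate vertices.\<close>

lemma exponential_upper:
  assumes e: "expo g" and w0: "weight g"
  obtains m :: nat and c :: real where "0 < m" "0 < c" "c < 1"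
    "\<And>k w v. w \<in> T \<Longrightarrow> v \<in> desc w \<Longrightarrow> ht w + k * m \<le> ht v \<Longrightarrow> g v \<le> c ^ k * g w"
proof -
  obtain m c where c: "c \<in> {0<..<1}"
    and m: "\<forall>w\<in>T. \<forall>v\<in>desc w. ht v \<ge> ht w + m \<longrightarrow> g v \<le> c * g w"
    using e unfolding exponential_def by blast
  \<comment> \<open>With \<open>m = 0\<close> the decay would apply to the root and itself.
    Positivity is what later permits division of heights by \<open>m\<close>.\<close>
  have m0: "m \<noteq> 0"
  proof
    assume "m = 0"
    then have "g \<phi> \<le> c * g \<phi>" using m root desc_refl by auto
    then show False using weight_root[OF w0] c by auto
  qed
  have "g v \<le> c ^ k * g w" if "w \<in> T" "v \<in> desc w" "ht w + k * m \<le> ht v" for k w v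
    using that
  proof (induction k arbitrary: v)
    case 0
    then show ?case using weight_desc w0 by auto
  next
    case (Suc k)
    obtain u where u: "u \<in> desc w" "v \<in> desc u" "ht u = ht w + k * m"
      using desc_between[of v w "ht w + k * m"] Suc by auto
    have "g v \<le> c * g u" using m u Suc(4) desc_in by auto
    also have "\<dots> \<le> c * (c ^ k * g w)" using Suc(1)[of u] u Suc c by auto
    finally show ?case by simp
  qed
  then show thesis using that[of m c] c m0 by auto
qed

lemma exponential_lower:
  assumes e: "expo g" and w0: "weight g"
  obtains c :: real where "0 < c" "c < 1"
    "\<And>w v. w \<in> T \<Longrightarrow> v \<in> chl w \<Longrightarrow> c * g w \<le> g v"
    "\<And>w v. w \<in> T \<Longrightarrow> v \<in> desc w \<Longrightarrow> c ^ (ht v - ht w) * g w \<le> g v"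
    "\<And>s w. w \<in> sc g s \<Longrightarrow> s \<le> 1 \<Longrightarrow> c * s \<le> g w"
proof -
  obtain c where c: "c \<in> {0<..<1}" "\<And>w v. w \<in> T \<Longrightarrow> v \<in> chl w \<Longrightarrow> c * g w \<le> g v"
    using e unfolding exponential_def by blast
  have par: "c * g (par v) \<le> g v" if "v \<in> T" "v \<noteq> \<phi>" for v
    using c(2)[of "par v" v] that chl_iff par_closed by blast
  have 2: "c ^ (ht v - ht w) * g w \<le> g v" if "w \<in> T" "v \<in> desc w" for w v
    using that(2,1)
  proof (induction rule: desc_induct)
    case (step v)
    have "ht v - ht w = Suc (ht (par v) - ht w)"
      using step ht_par[of v] desc_ht[of "par v" w] that by auto
    then have "c ^ (ht v - ht w) * g w = c * (c ^ (ht (par v) - ht w) * g w)" by simp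
    also have "\<dots> \<le> c * g (par v)" using step c by auto
    finally show ?case using par step by fastforce
  qed simp
  \<comment> \<open>Below the root, the parent of a scale cell has weight above \<open>s\<close>,
    and one step down loses at most the factor \<open>c\<close>. At the root the bound
    \<open>s \<le> 1\<close> is what suffices.\<close>
  have 3: "c * s \<le> g w" if "w \<in> sc g s" "s \<le> 1" for s w
  proof (cases "w = \<phi>")
    case True
    have "c * s \<le> 1 * 1" using c that
      by (metis greaterThanLessThan_iff less_imp_le mult_left_mono mult_left_le order_trans mult_1_right)
    then show ?thesis using True weight_root[OF w0] by simp
  next
    case False
    then have "s \<le> g (par w)" "w \<in> T" using that by (auto simp: scale_def split: if_splits)
    moreover have "c * s \<le> c * g (par w)" using calculation c by auto
    ultimately show ?thesis using par False by fastforce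
  qed
  show thesis using that[of c] c 2 3 by auto
qed

text \<open>For a height gap \<open>n\<close>, the weight \<open>a\<close> shrinks at most by
  \<open>ca ^ n\<close>, while \<open>b\<close> shrinks at least by \<open>c ^ (n div m)\<close>.
  The exponent solves \<open>c = (ca ^ m) powr p\<close>, and the constant \<open>1 / c\<close> pays
  for rounding \<open>n\<close> up to a multiple of \<open>m\<close>.\<close>

lemma exponential_compare:
  assumes a: "weight a" "expo a" and b: "weight b" "expo b"
  obtains C p :: real where "0 < C" "0 < p"
    "\<And>w v. w \<in> T \<Longrightarrow> v \<in> desc w \<Longrightarrow> b v \<le> C * b w * (a v / a w) powr p"
proof -
  obtain ca where ca: "0 < ca" "ca < 1"
    "\<And>w v. w \<in> T \<Longrightarrow> v \<in> desc w \<Longrightarrow> ca ^ (ht v - ht w) * a w \<le> a v"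
    using exponential_lower[OF a(2,1)] by metis
  obtain m c where c: "0 < m" "0 < c" "c < 1"
    "\<And>k w v. w \<in> T \<Longrightarrow> v \<in> desc w \<Longrightarrow> ht w + k * m \<le> ht v \<Longrightarrow> b v \<le> c ^ k * b w"
    using exponential_upper[OF b(2,1)] by metis
  have e: "0 < ca ^ m" "ca ^ m < 1" using ca c by (auto simp: power_less_one_iff)
  obtain p where p: "0 < p" "c = (ca ^ m) powr p" using power_base_change[OF c(2,3) e] by blast
  have "b v \<le> (1 / c) * b w * (a v / a w) powr p" if w: "w \<in> T" "v \<in> desc w" for w v
  proof -
    define n where "n = ht v - ht w"
    define k where "k = n div m"
    have pos: "0 < a w" "0 < b w" using weight_pos a b w by auto
    have hv: "ht v = ht w + n" using desc_ht[OF w(2,1)] by (simp add: n_def)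
    have "n \<le> m * Suc k" using c(1) dividend_less_div_times[of m n]
      unfolding k_def by (auto simp: algebra_simps)
    then have "ca ^ (m * Suc k) \<le> ca ^ n" using ca by (intro power_decreasing) auto
    also have "\<dots> \<le> a v / a w" using ca(3)[OF w] pos by (simp add: n_def pos_le_divide_eq)
    finally have "(ca ^ m) ^ Suc k \<le> a v / a w" by (simp only: power_mult)
    then have "((ca ^ m) ^ Suc k) powr p \<le> (a v / a w) powr p"
      using e p by (intro powr_mono2) auto
    then have le: "c ^ Suc k \<le> (a v / a w) powr p"
      unfolding p(2) using power_powr_swap[OF e(1), of "Suc k" p] by simp
    have "b v \<le> c ^ k * b w" using c(4)[OF w, of k] hv by (simp add: k_def)
    also have "\<dots> = (1 / c) * b w * c ^ Suc k" using c by simp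
    also have "\<dots> \<le> (1 / c) * b w * (a v / a w) powr p"
      using le pos c by (intro mult_left_mono) auto
    finally show ?thesis .
  qed
  then show thesis using that[of "1 / c" p] c p by auto
qed

text \<open>This is the comparison with the roles of \<open>a\<close> and \<open>b\<close>
  exchanged, solved for \<open>b w / b v\<close>; the exponent therefore becomes
  \<open>1/p\<close>.\<close>

lemma exponential_compare_reverse:
  assumes a: "weight a" "expo a" and b: "weight b" "expo b"
  obtains C p :: real where "0 < C" "0 < p"
    "\<And>w v. w \<in> T \<Longrightarrow> v \<in> desc w \<Longrightarrow> b w \<le> C * b v * (a w / a v) powr p"
proof -
  obtain C p where C: "0 < C" "0 < p"
    "\<And>w v. w \<in> T \<Longrightarrow> v \<in> desc w \<Longrightarrow> a v \<le> C * a w * (b v / b w) powr p"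
    using exponential_compare[OF b a] by metis
  have "b w \<le> C powr (1/p) * b v * (a w / a v) powr (1/p)" if w: "w \<in> T" "v \<in> desc w" for w v
  proof -
    have pos: "0 < a w" "0 < b w" "0 < a v" "0 < b v" using weight_pos a b w desc_in by auto
    have "(b w / b v) powr p * (b v / b w) powr p = 1"
      using pos by (simp add: powr_mult[symmetric])
    then have "(b w / b v) powr p * a v \<le> C * a w"
      using mult_left_mono[OF C(3)[OF w], of "(b w / b v) powr p"] by (simp add: algebra_simps)
    then have "(b w / b v) powr p \<le> C * (a w / a v)"
      using pos by (simp add: field_simps)
    then have "((b w / b v) powr p) powr (1/p) \<le> (C * (a w / a v)) powr (1/p)"
      using C by (intro powr_mono2) auto
    moreover have "((b w / b v) powr p) powr (1/p) = b w / b v"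
      using C(2) pos by (simp add: powr_powr)
    moreover have "(C * (a w / a v)) powr (1/p) = C powr (1/p) * (a w / a v) powr (1/p)"
      by (rule powr_mult)
    ultimately have "b w / b v \<le> C powr (1/p) * (a w / a v) powr (1/p)" by (simp only:)
    then show ?thesis using pos by (simp add: field_simps)
  qed
  then show thesis using that[of "C powr (1/p)" "1/p"] C by auto
qed

end

section \<open>Quasisymmetry of normalized metrics\<close>

text \<open>The supremum in \<^const>\<open>mdiam\<close> is over a bounded set because the space is compact.\<close>

locale compact_topology =
  fixes X :: "'x topology"
  assumes compact: "compact_space X"
begin

lemma metric_space: "d \<in> metrics X \<Longrightarrow> Metric_space (topspace X) d"
  by (simp add: metrics_def)

lemma dist_nonneg: "d \<in> metrics X \<Longrightarrow> 0 \<le> d x y"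
  and dist_commute: "d \<in> metrics X \<Longrightarrow> d x y = d y x"
  and dist_zero: "d \<in> metrics X \<Longrightarrow> x \<in> topspace X \<Longrightarrow> y \<in> topspace X \<Longrightarrow> d x y = 0 \<longleftrightarrow> x = y"
  and dist_triangle: "d \<in> metrics X \<Longrightarrow> x \<in> topspace X \<Longrightarrow> y \<in> topspace X \<Longrightarrow> z \<in> topspace X \<Longrightarrow>
        d x z \<le> d x y + d y z"
  using metric_space Metric_space.nonneg Metric_space.commute Metric_space.zero
    Metric_space.triangle by metis+

lemma dist_bounded:
  assumes "d \<in> metrics X"
  obtains B where "\<And>x y. x \<in> topspace X \<Longrightarrow> y \<in> topspace X \<Longrightarrow> d x y \<le> B"
proof -
  interpret Metric_space "topspace X" d using metric_space assms by blast
  have "mtopology = X" using assms by (simp add: metrics_def)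
  then have "compactin mtopology (topspace X)" using compact by (simp add: compact_space_def)
  then have "mbounded (topspace X)" by (rule compactin_imp_mbounded)
  then obtain B where "\<forall>x\<in>topspace X. \<forall>y\<in>topspace X. d x y \<le> B"
    unfolding mbounded_alt by blast
  then show thesis using that by blast
qed

lemma mdiam_upper:
  assumes d: "d \<in> metrics X" and S: "S \<subseteq> topspace X" "x \<in> S" "y \<in> S"
  shows "d x y \<le> mdiam d S"
proof -
  obtain B where B: "\<And>x y. x \<in> topspace X \<Longrightarrow> y \<in> topspace X \<Longrightarrow> d x y \<le> B"
    using dist_bounded[OF d] by blast
  have "bdd_above ((\<lambda>(x, y). d x y) ` (S \<times> S))"
    by (rule bdd_aboveI2[of _ _ B]) (use B S in auto)
  then have "(\<lambda>(x, y). d x y) (x, y) \<le> mdiam d S"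
    unfolding mdiam_def using S by (intro cSUP_upper) auto
  then show ?thesis by simp
qed

lemma mdiam_least:
  assumes "S \<noteq> {}" "\<And>x y. x \<in> S \<Longrightarrow> y \<in> S \<Longrightarrow> d x y \<le> B"
  shows "mdiam d S \<le> B"
  unfolding mdiam_def using assms by (intro cSUP_least) auto

lemma mdiam_mono:
  assumes "d \<in> metrics X" "S \<noteq> {}" "S \<subseteq> S'" "S' \<subseteq> topspace X"
  shows "mdiam d S \<le> mdiam d S'"
  by (rule mdiam_least[OF assms(2)]) (use assms mdiam_upper in blast)

lemma mdiam_le_radius:
  assumes d: "d \<in> metrics X" and S: "S \<noteq> {}" "S \<subseteq> topspace X" and x: "x \<in> topspace X"
    and r: "\<And>z. z \<in> S \<Longrightarrow> d x z \<le> r"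
  shows "mdiam d S \<le> 2 * r"
proof (rule mdiam_least[OF S(1)])
  fix y z assume yz: "y \<in> S" "z \<in> S"
  have "d y z \<le> d y x + d x z" using dist_triangle[OF d] yz S x by blast
  then show "d y z \<le> 2 * r" using r[OF yz(1)] r[OF yz(2)] dist_commute[OF d, of y x] by simp
qed

text \<open>If all points of \<open>S\<close> were within a third of the diameter from
  \<open>x\<close>, the diameter would be at most two thirds of itself. The factor 3 thus replaces
  an argument that the supremum is attained.\<close>

lemma far_point:
  assumes d: "d \<in> metrics X" and S: "S \<subseteq> topspace X" "x \<in> S"
  obtains y where "y \<in> S" "mdiam d S \<le> 3 * d x y"
proof -
  have "\<exists>y\<in>S. mdiam d S \<le> 3 * d x y"
  proof (rule ccontr)
    assume "\<not> ?thesis"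
    then have far: "d x y \<le> mdiam d S / 3" "3 * d x y < mdiam d S" if "y \<in> S" for y
      using that by force+
    have "mdiam d S \<le> 2 * (mdiam d S / 3)"
    proof (rule mdiam_le_radius[OF d])
      show "S \<noteq> {}" "x \<in> topspace X" using S by auto
      show "S \<subseteq> topspace X" by (rule S(1))
      show "d x z \<le> mdiam d S / 3" if "z \<in> S" for z using far(1) that .
    qed
    then show False using far(2)[OF S(2)] dist_nonneg[OF d, of x x] by simp
  qed
  then show thesis using that by blast
qed

text \<open>This form of quasisymmetry refers to no homeomorphism and is visibly symmetric, since the
  two clauses are contrapositives of each other with the metrics exchanged.\<close>

definition qs_control :: "('x \<Rightarrow> 'x \<Rightarrow> real) \<Rightarrow> ('x \<Rightarrow> 'x \<Rightarrow> real) \<Rightarrow> bool" where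
  "qs_control \<rho> d \<longleftrightarrow>
     (\<forall>t>0. \<exists>H>0. \<forall>x\<in>topspace X. \<forall>y\<in>topspace X. \<forall>z\<in>topspace X.
        d x z \<le> t * d x y \<longrightarrow> \<rho> x z \<le> H * \<rho> x y) \<and>
     (\<forall>\<epsilon>>0. \<exists>t>0. \<forall>x\<in>topspace X. \<forall>y\<in>topspace X. \<forall>z\<in>topspace X.
        d x z \<le> t * d x y \<longrightarrow> \<rho> x z \<le> \<epsilon> * \<rho> x y)"

lemma qs_controlE1:
  assumes "qs_control \<rho> d" "0 < t"
  obtains H where "0 < H" "\<And>x y z. x \<in> topspace X \<Longrightarrow> y \<in> topspace X \<Longrightarrow> z \<in> topspace X \<Longrightarrow>
    d x z \<le> t * d x y \<Longrightarrow> \<rho> x z \<le> H * \<rho> x y"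
  using assms unfolding qs_control_def by metis

lemma qs_controlE2:
  assumes "qs_control \<rho> d" "0 < \<epsilon>"
  obtains t where "0 < t" "\<And>x y z. x \<in> topspace X \<Longrightarrow> y \<in> topspace X \<Longrightarrow> z \<in> topspace X \<Longrightarrow>
    d x z \<le> t * d x y \<Longrightarrow> \<rho> x z \<le> \<epsilon> * \<rho> x y"
  using assms unfolding qs_control_def by metis

lemma qs_control_sym:
  assumes d: "d \<in> metrics X" and \<rho>: "\<rho> \<in> metrics X" and c: "qs_control \<rho> d"
  shows "qs_control d \<rho>"
  unfolding qs_control_def
proof (intro conjI allI impI)
  fix t :: real assume t: "0 < t"
  \<comment> \<open>The factor 2 makes the contradiction strict: if the desired bound fails,
    \<open>y\<close> and \<open>z\<close> exchange roles and \<open>\<rho> x y\<close> is at most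
    half of itself. Then \<open>x = y\<close>, and all three points coincide.\<close>
  then have "0 < 1 / (2 * t)" by simp
  from qs_controlE2[OF c this] obtain \<delta> where \<delta>: "0 < \<delta>" "\<And>x y z. x \<in> topspace X \<Longrightarrow> y \<in> topspace X \<Longrightarrow> z \<in> topspace X \<Longrightarrow>
    d x z \<le> \<delta> * d x y \<Longrightarrow> \<rho> x z \<le> 1 / (2 * t) * \<rho> x y"
    by blast
  have "d x z \<le> (1 / \<delta>) * d x y"
    if x: "x \<in> topspace X" "y \<in> topspace X" "z \<in> topspace X" and le: "\<rho> x z \<le> t * \<rho> x y" for x y z
  proof (rule ccontr)
    assume nle: "\<not> ?thesis"
    then have "d x y \<le> \<delta> * d x z" using \<delta> by (simp add: field_simps)
    then have "\<rho> x y \<le> 1 / (2 * t) * \<rho> x z" using \<delta>(2)[of x z y] x by blast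
    also have "\<dots> \<le> 1 / (2 * t) * (t * \<rho> x y)" using le t by (intro mult_left_mono) auto
    finally have "\<rho> x y \<le> 0" using t by simp
    then have "x = y" using dist_nonneg[OF \<rho>, of x y] dist_zero[OF \<rho>] x by force
    then have "\<rho> x y = 0" using dist_zero[OF \<rho>] x by blast
    then have "\<rho> x z = 0" using le dist_nonneg[OF \<rho>, of x z] by simp
    then have "x = z" using dist_zero[OF \<rho>] x by blast
    then have "d x z = 0" using dist_zero[OF d] x by blast
    then show False using nle dist_nonneg[OF d, of x y] \<delta>(1) by simp
  qed
  then show "\<exists>H>0. \<forall>x\<in>topspace X. \<forall>y\<in>topspace X. \<forall>z\<in>topspace X.
        \<rho> x z \<le> t * \<rho> x y \<longrightarrow> d x z \<le> H * d x y"
    using \<delta>(1) by (intro exI[of _ "1 / \<delta>"]) auto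
next
  fix \<epsilon> :: real assume \<epsilon>: "0 < \<epsilon>"
  then have "0 < 1 / \<epsilon>" by simp
  from qs_controlE1[OF c this] obtain H where H: "0 < H" "\<And>x y z. x \<in> topspace X \<Longrightarrow> y \<in> topspace X \<Longrightarrow> z \<in> topspace X \<Longrightarrow>
    d x z \<le> 1 / \<epsilon> * d x y \<Longrightarrow> \<rho> x z \<le> H * \<rho> x y"
    by blast
  have "d x z \<le> \<epsilon> * d x y"
    if x: "x \<in> topspace X" "y \<in> topspace X" "z \<in> topspace X" and le: "\<rho> x z \<le> 1 / (2 * H) * \<rho> x y" for x y z
  proof (rule ccontr)
    assume nle: "\<not> ?thesis"
    then have "d x y \<le> 1 / \<epsilon> * d x z" using \<epsilon> by (simp add: field_simps)
    then have "\<rho> x y \<le> H * \<rho> x z" using H(2)[of x z y] x by blast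
    also have "\<dots> \<le> H * (1 / (2 * H) * \<rho> x y)" using le H by (intro mult_left_mono) auto
    finally have "\<rho> x y \<le> 0" using H by simp
    then have "x = y" using dist_nonneg[OF \<rho>, of x y] dist_zero[OF \<rho>] x by force
    then have "\<rho> x y = 0" using dist_zero[OF \<rho>] x by blast
    then have "\<rho> x z = 0" using le dist_nonneg[OF \<rho>, of x z] by simp
    then have "x = z" using dist_zero[OF \<rho>] x by blast
    then have "d x z = 0" using dist_zero[OF d] x by blast
    then show False using nle dist_nonneg[OF d, of x y] \<epsilon> by simp
  qed
  then show "\<exists>t>0. \<forall>x\<in>topspace X. \<forall>y\<in>topspace X. \<forall>z\<in>topspace X.
        \<rho> x z \<le> t * \<rho> x y \<longrightarrow> d x z \<le> \<epsilon> * d x y"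
    using H(1) by (intro exI[of _ "1 / (2 * H)"]) auto
qed

lemma quasisymmetric_imp_control:
  assumes d: "d \<in> metrics X" and \<rho>: "\<rho> \<in> metrics X" and qs: "quasisymmetric_to X \<rho> d"
  shows "qs_control \<rho> d"
proof -
  obtain h :: "real \<Rightarrow> real" where h: "homeomorphic_map (top_of_set {0..}) (top_of_set {0..}) h" "h 0 = 0"
    and qs: "\<And>t x y z. 0 < t \<Longrightarrow> x \<in> topspace X \<Longrightarrow> y \<in> topspace X \<Longrightarrow> z \<in> topspace X \<Longrightarrow>
           d x z < t * d x y \<Longrightarrow> \<rho> x z < h t * \<rho> x y"
    using qs unfolding quasisymmetric_to_def by metis
  have cont: "continuous_on {0..} h"
    using homeomorphic_imp_continuous_map[OF h(1)] by (simp add: continuous_map_in_subtopology)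
  have nonneg: "0 \<le> h t" if "0 \<le> t" for t
    using homeomorphic_imp_surjective_map[OF h(1)] that by auto
  \<comment> \<open>Doubling \<open>t\<close> makes the hypothesis strict when \<open>x\<close> and
    \<open>y\<close> differ. When they coincide, so does \<open>z\<close>, and both sides
    vanish.\<close>
  have weak: "\<rho> x z \<le> h (2 * t) * \<rho> x y"
    if x: "x \<in> topspace X" "y \<in> topspace X" "z \<in> topspace X" and t: "0 < t" "d x z \<le> t * d x y" for x y z t
  proof (cases "x = y")
    case True
    then have "d x z = 0" using t dist_zero[OF d, of x y] dist_nonneg[OF d, of x z] x by simp
    then have "x = z" using dist_zero[OF d] x by blast
    then show ?thesis using True dist_zero[OF \<rho>, of x x] x by simp
  next
    case False
    then have "0 < d x y" using dist_zero[OF d] dist_nonneg[OF d, of x y] x by force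
    then have "0 < t * d x y" using t by simp
    then have "d x z < 2 * t * d x y" using t by simp
    then show ?thesis using qs[of "2 * t" x y z] x t by simp
  qed
  show ?thesis
    unfolding qs_control_def
  proof (intro conjI allI impI)
    fix t :: real assume t: "0 < t"
    have "\<rho> x z \<le> (h (2 * t) + 1) * \<rho> x y"
      if "x \<in> topspace X" "y \<in> topspace X" "z \<in> topspace X" "d x z \<le> t * d x y" for x y z
      using weak[OF that(1-3) t that(4)] dist_nonneg[OF \<rho>, of x y] by (simp add: algebra_simps)
    then show "\<exists>H>0. \<forall>x\<in>topspace X. \<forall>y\<in>topspace X. \<forall>z\<in>topspace X.
        d x z \<le> t * d x y \<longrightarrow> \<rho> x z \<le> H * \<rho> x y"
      using nonneg[of "2 * t"] t by (intro exI[of _ "h (2 * t) + 1"]) auto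
  next
    fix \<epsilon> :: real assume \<epsilon>: "0 < \<epsilon>"
    obtain \<delta> where \<delta>: "0 < \<delta>" "\<And>t. 0 \<le> t \<Longrightarrow> dist t 0 < \<delta> \<Longrightarrow> dist (h t) (h 0) < \<epsilon>"
      using cont \<epsilon> unfolding continuous_on_iff by (metis atLeast_iff order_refl)
    \<comment> \<open>Continuity of \<open>h\<close> at 0 gives the second clause;
      \<open>\<delta> / 4\<close> allows for the doubling in \<open>weak\<close>.\<close>
    have "h (2 * (\<delta> / 4)) \<le> \<epsilon>" using \<delta>(2)[of "\<delta> / 2"] \<delta>(1) h(2) by (simp add: dist_real_def)
    then have "\<rho> x z \<le> \<epsilon> * \<rho> x y"
      if "x \<in> topspace X" "y \<in> topspace X" "z \<in> topspace X" "d x z \<le> \<delta> / 4 * d x y" for x y z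
      using weak[OF that(1-3) _ that(4)] \<delta>(1) mult_right_mono[OF _ dist_nonneg[OF \<rho>, of x y]]
      by (meson divide_pos_pos order_trans zero_less_numeral)
    then show "\<exists>t>0. \<forall>x\<in>topspace X. \<forall>y\<in>topspace X. \<forall>z\<in>topspace X.
        d x z \<le> t * d x y \<longrightarrow> \<rho> x z \<le> \<epsilon> * \<rho> x y"
      using \<delta>(1) by (intro exI[of _ "\<delta> / 4"]) auto
  qed
qed

end

text \<open>The map is continuous and strictly increasing from 0, and the intermediate value theorem
  makes it onto, so it is a homeomorphism of the half-line. It will serve as the control function
  for the converse.\<close>

lemma homeomorphic_map_powr_sum:
  fixes C p q :: real
  assumes "0 < C" "0 < p" "0 < q"
  shows "homeomorphic_map (top_of_set {0..}) (top_of_set {0..}) (\<lambda>t. C * (t powr p + t powr q))"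
proof -
  let ?h = "\<lambda>t::real. C * (t powr p + t powr q)"
  have cont: "continuous_on {0..} ?h"
    using assms by (intro continuous_intros continuous_on_powr') auto
  have mono: "?h s < ?h t" if "0 \<le> s" "s < t" for s t
    using assms that by (intro mult_strict_left_mono add_strict_mono powr_less_mono2) auto
  then have inj: "inj_on ?h {0..}"
    by (metis (no_types, lifting) atLeast_iff inj_onI linorder_neq_iff)
  have im: "?h ` {0..} = {0..}"
  proof (intro equalityI subsetI)
    fix y :: real assume y: "y \<in> {0..}"
    \<comment> \<open>At this point the first summand alone, times \<open>C\<close>, already equals
      \<open>y\<close>.\<close>
    define B where "B = (y / C) powr (1 / p)"
    have "B powr p = y / C" using y assms by (simp add: B_def powr_powr)
    then have "?h B \<ge> y" using assms by (simp add: field_simps)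
    moreover have "?h 0 \<le> y" "0 \<le> B" using y by (simp_all add: B_def)
    moreover have "continuous_on {0..B} ?h" using cont by (rule continuous_on_subset) auto
    ultimately obtain t where "0 \<le> t" "t \<le> B" "?h t = y" using IVT'[of ?h 0 y B] by blast
    then show "y \<in> ?h ` {0..}" by auto
  qed (use assms in auto)
  obtain g where "homeomorphism {0..} {0..} ?h g"
    using homeomorphism_into_1d[OF _ cont im inj] is_interval_path_connected[of "{0::real..}"] by auto
  then have "homeomorphic_maps (top_of_set {0..}) (top_of_set {0..}) ?h g"
    by (auto simp: homeomorphic_maps_def homeomorphism_def continuous_map_in_subtopology)
  then show ?thesis by (rule homeomorphic_maps_map[THEN iffD1, THEN conjunct1])
qed

section \<open>Diameters of cells\<close>

locale compact_partition = partitioned_tree T A \<phi> X K + compact_topology X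
  for T :: "'t set" and A :: "'t \<Rightarrow> 't \<Rightarrow> nat" and \<phi> :: 't
    and X :: "'x topology" and K :: "'t \<Rightarrow> 'x set"
begin

abbreviation "dw \<equiv> diam_weight K"
abbreviation "nbhd \<equiv> chain_nbhd T A \<phi> K"

lemma dw_upper:
  "d \<in> metrics X \<Longrightarrow> w \<in> T \<Longrightarrow> x \<in> K w \<Longrightarrow> y \<in> K w \<Longrightarrow> d x y \<le> dw d w"
  unfolding diam_weight_def by (rule mdiam_upper) (use cell_subset in auto)

lemma dw_mono: "d \<in> metrics X \<Longrightarrow> v \<in> desc w \<Longrightarrow> w \<in> T \<Longrightarrow> dw d v \<le> dw d w"
  unfolding diam_weight_def
  by (rule mdiam_mono) (use cell_subset cell_nonempty cell_mono desc_in in blast)+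

lemma dw_root: "d \<in> metrics X \<Longrightarrow> dw d \<phi> = 1"
  by (simp add: diam_weight_def cell_root metrics_def)

lemma dw_nonneg:
  assumes "d \<in> metrics X" "w \<in> T"
  shows "0 \<le> dw d w"
proof -
  obtain x where "x \<in> K w" using cell_nonempty assms by blast
  then show ?thesis using dw_upper[OF assms, of x x] dist_nonneg[OF assms(1), of x x] by simp
qed

text \<open>The 3 in the hypothesis pays for the nearly farthest point, the 2 in the conclusion for
  passing from a radius around the common point to a diameter. \<open>H\<close> and \<open>t\<close>
  are left free so that either clause of \<open>qs_control\<close> can be inserted.\<close>

lemma dw_transfer:
  assumes d: "d \<in> metrics X" and \<rho>: "\<rho> \<in> metrics X" and H: "0 \<le> H"
    and le: "\<And>x y z. x \<in> topspace X \<Longrightarrow> y \<in> topspace X \<Longrightarrow> z \<in> topspace X \<Longrightarrow>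
      d x z \<le> 3 * t * d x y \<Longrightarrow> \<rho> x z \<le> H * \<rho> x y"
    and vw: "v \<in> T" "w \<in> T" "K v \<inter> K w \<noteq> {}" "dw d v \<le> t * dw d w" and t: "0 \<le> t"
  shows "dw \<rho> v \<le> 2 * H * dw \<rho> w"
proof -
  obtain x where x: "x \<in> K v" "x \<in> K w" using vw by blast
  obtain y where y: "y \<in> K w" "dw d w \<le> 3 * d x y"
    unfolding diam_weight_def by (rule far_point[OF d cell_subset[OF vw(2)] x(2)])
  have X: "x \<in> topspace X" "y \<in> topspace X" "K v \<subseteq> topspace X" using x y cell_subset vw by blast+
  have "\<rho> x z \<le> H * dw \<rho> w" if z: "z \<in> K v" for z
  proof -
    have "d x z \<le> t * dw d w" using dw_upper[OF d vw(1) x(1) z] vw(4) by simp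
    also have "\<dots> \<le> t * (3 * d x y)" using t y by (intro mult_left_mono) auto
    finally have "\<rho> x z \<le> H * \<rho> x y" using le[of x y z] X z by (simp add: subset_eq mult_ac)
    also have "\<dots> \<le> H * dw \<rho> w" using dw_upper[OF \<rho> vw(2) x(2) y(1)] H by (intro mult_left_mono) auto
    finally show ?thesis .
  qed
  then have "mdiam \<rho> (K v) \<le> 2 * (H * dw \<rho> w)"
    using mdiam_le_radius[OF \<rho> cell_nonempty[OF vw(1)] X(3,1)] by blast
  then show ?thesis by (simp add: diam_weight_def)
qed

lemma dw_transfer_bound:
  assumes d: "d \<in> metrics X" and \<rho>: "\<rho> \<in> metrics X" and c: "qs_control \<rho> d" and t: "0 < t"
  obtains H where "0 < H" "\<And>v w. v \<in> T \<Longrightarrow> w \<in> T \<Longrightarrow> K v \<inter> K w \<noteq> {} \<Longrightarrow>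
    dw d v \<le> t * dw d w \<Longrightarrow> dw \<rho> v \<le> H * dw \<rho> w"
proof -
  have "0 < 3 * t" using t by simp
  from qs_controlE1[OF c this] obtain H where H: "0 < H"
    "\<And>x y z. x \<in> topspace X \<Longrightarrow> y \<in> topspace X \<Longrightarrow> z \<in> topspace X \<Longrightarrow>
      d x z \<le> 3 * t * d x y \<Longrightarrow> \<rho> x z \<le> H * \<rho> x y" by blast
  show thesis
  proof (rule that[of "2 * H"])
    show "dw \<rho> v \<le> 2 * H * dw \<rho> w"
      if "v \<in> T" "w \<in> T" "K v \<inter> K w \<noteq> {}" "dw d v \<le> t * dw d w" for v w
      by (rule dw_transfer[OF d \<rho> less_imp_le[OF H(1)] H(2) that less_imp_le[OF t]])
  qed (use H in simp)
qed

lemma dw_transfer_small: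
  assumes d: "d \<in> metrics X" and \<rho>: "\<rho> \<in> metrics X" and c: "qs_control \<rho> d" and \<epsilon>: "0 < \<epsilon>"
  obtains t where "0 < t" "\<And>v w. v \<in> T \<Longrightarrow> w \<in> T \<Longrightarrow> K v \<inter> K w \<noteq> {} \<Longrightarrow>
    dw d v \<le> t * dw d w \<Longrightarrow> dw \<rho> v \<le> \<epsilon> * dw \<rho> w"
proof -
  have \<epsilon>2: "0 < \<epsilon> / 2" using \<epsilon> by simp
  from qs_controlE2[OF c this] obtain t where t: "0 < t"
    "\<And>x y z. x \<in> topspace X \<Longrightarrow> y \<in> topspace X \<Longrightarrow> z \<in> topspace X \<Longrightarrow>
      d x z \<le> t * d x y \<Longrightarrow> \<rho> x z \<le> \<epsilon> / 2 * \<rho> x y" by blast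
  have t3: "0 < t / 3" using t by simp
  have le: "\<rho> x z \<le> \<epsilon> / 2 * \<rho> x y"
    if "x \<in> topspace X" "y \<in> topspace X" "z \<in> topspace X" "d x z \<le> 3 * (t / 3) * d x y" for x y z
    using t(2) that by simp
  show thesis
  proof (rule that[OF t3])
    show "dw \<rho> v \<le> \<epsilon> * dw \<rho> w"
      if "v \<in> T" "w \<in> T" "K v \<inter> K w \<noteq> {}" "dw d v \<le> t / 3 * dw d w" for v w
      using dw_transfer[OF d \<rho> less_imp_le[OF \<epsilon>2] le that less_imp_le[OF t3]] by simp
  qed
qed

text \<open>Each link adds one diameter by the triangle inequality. The bound covers points of every
  cell of the chain, since the transfer of adaptedness must control the diameters of all of
  them.\<close>

lemma chain_dist:
  assumes d: "d \<in> metrics X"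
    and w: "\<And>i. i \<le> M \<Longrightarrow> w i \<in> T" "\<And>i. i \<le> M \<Longrightarrow> dw d (w i) \<le> r"
    and meet: "\<And>i. i < M \<Longrightarrow> K (w i) \<inter> K (w (Suc i)) \<noteq> {}" and x: "x \<in> K (w 0)"
    and iz: "i \<le> M" "z \<in> K (w i)"
  shows "d x z \<le> (real i + 1) * r"
  using iz
proof (induction i arbitrary: z)
  case 0
  then show ?case using dw_upper[OF d w(1) x, of z] w(2)[of 0] by simp
next
  case (Suc i)
  obtain p where p: "p \<in> K (w i)" "p \<in> K (w (Suc i))" using meet[of i] Suc by auto
  have X: "x \<in> topspace X" "p \<in> topspace X" "z \<in> topspace X"
    using x p Suc cell_subset[OF w(1)] by blast+
  have "d x z \<le> d x p + d p z" by (rule dist_triangle[OF d X])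
  moreover have "d x p \<le> (real i + 1) * r" using Suc p by simp
  moreover have "d p z \<le> r"
    using dw_upper[OF d w(1) p(2) Suc(3)] w(2)[of "Suc i"] Suc(2) by simp
  ultimately show ?case by (simp add: algebra_simps)
qed

section \<open>Quasisymmetric metrics are adapted\<close>

lemma level_nonempty: "level T A \<phi> m \<noteq> {}"
proof -
  obtain x where "x \<in> K \<phi>" using cell_nonempty root by blast
  from cell_ray_exists[OF root this] obtain \<omega> where r: "cell_ray x \<omega>" "\<omega> 0 = \<phi>" by blast
  then have "\<omega> m \<in> level T A \<phi> m"
    using cell_ray_desc(2)[OF r(1), of 0 m] by (simp add: level_def cell_ray_def)
  then show ?thesis by blast
qed

text \<open>A cell of \<open>\<rho>\<close>-diameter 0 is a single point, hence has
  \<open>d\<close>-diameter 0, which is excluded. For the limit every cell is compared with the root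
  cell, which meets it and has diameter 1 in both metrics.\<close>

lemma weight_transfer:
  assumes d: "d \<in> metrics X" and \<rho>: "\<rho> \<in> metrics X" and c: "qs_control \<rho> d"
    and wd: "weight (dw d)"
  shows "weight (dw \<rho>)"
proof -
  have pos: "0 < dw \<rho> w" if w: "w \<in> T" for w
  proof (rule ccontr)
    assume "\<not> ?thesis"
    then have "d x y \<le> 0" if "x \<in> K w" "y \<in> K w" for x y
    proof -
      have X: "x \<in> topspace X" "y \<in> topspace X" using that cell_subset w by blast+
      have "\<rho> x y \<le> 0" using dw_upper[OF \<rho> w that] \<open>\<not> 0 < dw \<rho> w\<close> by simp
      then have "x = y" using dist_zero[OF \<rho> X] dist_nonneg[OF \<rho>, of x y] by simp
      then show ?thesis using dist_zero[OF d X] by simp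
    qed
    then have "dw d w \<le> 0" unfolding diam_weight_def by (rule mdiam_least[OF cell_nonempty[OF w]])
    then show False using weight_pos[OF wd w] by simp
  qed
  have le1: "dw \<rho> w \<le> 1" if w: "w \<in> T" for w
    using mdiam_mono[OF \<rho> cell_nonempty[OF w] cell_subset[OF w]] \<rho>
    by (simp add: metrics_def diam_weight_def)
  have par: "dw \<rho> w \<le> dw \<rho> (par w)" if w: "w \<in> T" for w
  proof (cases "w = \<phi>")
    case False
    then have "w \<in> desc (par w)" using desc_iff[OF w] desc_refl[OF par_closed[OF w]] by blast
    then show ?thesis using dw_mono[OF \<rho>] par_closed[OF w] by blast
  qed simp
  have lim: "(\<lambda>m. SUP w\<in>level T A \<phi> m. dw \<rho> w) \<longlonglongrightarrow> 0"
  proof (rule LIMSEQ_I)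
    fix r :: real assume r: "0 < r"
    then have "0 < r / 2" by simp
    from dw_transfer_small[OF d \<rho> c this] obtain t where t: "0 < t"
      "\<And>v w. v \<in> T \<Longrightarrow> w \<in> T \<Longrightarrow> K v \<inter> K w \<noteq> {} \<Longrightarrow>
        dw d v \<le> t * dw d w \<Longrightarrow> dw \<rho> v \<le> r / 2 * dw \<rho> w" by blast
    obtain N where N: "\<forall>w\<in>T. N \<le> ht w \<longrightarrow> dw d w < t"
      using weight_eventually_small[OF wd t(1)] by blast
    have small: "dw \<rho> w \<le> r / 2" if "w \<in> T" "N \<le> ht w" for w
    proof -
      have "dw d w \<le> t * dw d \<phi>" using N that dw_root[OF d] by (simp add: less_imp_le)
      moreover have "K w \<inter> K \<phi> \<noteq> {}"
        using cell_root cell_nonempty[OF that(1)] cell_subset[OF that(1)] by auto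
      ultimately show ?thesis using t(2)[OF that(1) root] dw_root[OF \<rho>] by simp
    qed
    have "norm ((SUP w\<in>level T A \<phi> m. dw \<rho> w) - 0) < r" if m: "N \<le> m" for m
    proof -
      obtain u where u: "u \<in> level T A \<phi> m" using level_nonempty by blast
      have "bdd_above (dw \<rho> ` level T A \<phi> m)"
        by (rule bdd_aboveI2[of _ _ 1]) (use le1 in \<open>auto simp: level_def\<close>)
      then have "dw \<rho> u \<le> (SUP w\<in>level T A \<phi> m. dw \<rho> w)" using u by (rule cSUP_upper[rotated])
      moreover have "0 < dw \<rho> u" using pos u by (simp add: level_def)
      moreover have "(SUP w\<in>level T A \<phi> m. dw \<rho> w) \<le> r / 2"
        by (rule cSUP_least[OF level_nonempty]) (use small m in \<open>auto simp: level_def\<close>)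
      ultimately show ?thesis using r by simp
    qed
    then show "\<exists>N. \<forall>m\<ge>N. norm ((SUP w\<in>level T A \<phi> m. dw \<rho> w) - 0) < r" by blast
  qed
  show ?thesis
    unfolding weight_function_def using pos le1 par lim dw_root[OF \<rho>] by blast
qed

lemma expo_transfer:
  assumes d: "d \<in> metrics X" and \<rho>: "\<rho> \<in> metrics X" and c: "qs_control \<rho> d"
    and wd: "weight (dw d)" and ed: "expo (dw d)"
  shows "expo (dw \<rho>)"
proof -
  have "0 < (1 / 2 :: real)" by simp
  from dw_transfer_small[OF d \<rho> c this] obtain t where t: "0 < t"
    "\<And>v w. v \<in> T \<Longrightarrow> w \<in> T \<Longrightarrow> K v \<inter> K w \<noteq> {} \<Longrightarrow>
      dw d v \<le> t * dw d w \<Longrightarrow> dw \<rho> v \<le> 1 / 2 * dw \<rho> w" by blast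
  obtain m :: nat and e :: real where m: "0 < m" "0 < e" "e < 1"
    "\<And>k w v. w \<in> T \<Longrightarrow> v \<in> desc w \<Longrightarrow> ht w + k * m \<le> ht v \<Longrightarrow> dw d v \<le> e ^ k * dw d w"
    using exponential_upper[OF ed wd] by metis
  \<comment> \<open>A gap of \<open>k * m\<close> levels pushes the ratio of
    \<open>d\<close>-diameters below \<open>t\<close>, which halves the
    \<open>\<rho>\<close>-diameter.\<close>
  obtain k where k: "e ^ k < t" using real_arch_pow_inv[OF t(1) m(3)] by blast
  have upper: "dw \<rho> v \<le> 1 / 2 * dw \<rho> w"
    if w: "w \<in> T" and v: "v \<in> desc w" "ht v \<ge> ht w + k * m" for w v
  proof -
    have "dw d v \<le> e ^ k * dw d w" using m(4)[OF w v] .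
    also have "\<dots> \<le> t * dw d w" using k dw_nonneg[OF d w] by (intro mult_right_mono) auto
    finally have "dw d v \<le> t * dw d w" .
    moreover have "K v \<inter> K w \<noteq> {}" using cell_mono[OF v(1) w] cell_nonempty[OF desc_in[OF v(1)]] by blast
    ultimately show ?thesis using t(2)[OF desc_in[OF v(1)] w] by blast
  qed
  obtain c2 :: real where c2: "0 < c2" "c2 < 1" "\<And>w v. w \<in> T \<Longrightarrow> v \<in> chl w \<Longrightarrow> c2 * dw d w \<le> dw d v"
    using exponential_lower[OF ed wd] by metis
  have "0 < 1 / c2" using c2 by simp
  from dw_transfer_bound[OF d \<rho> c this] obtain H where H: "0 < H"
    "\<And>v w. v \<in> T \<Longrightarrow> w \<in> T \<Longrightarrow> K v \<inter> K w \<noteq> {} \<Longrightarrow>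
      dw d v \<le> 1 / c2 * dw d w \<Longrightarrow> dw \<rho> v \<le> H * dw \<rho> w" by blast
  \<comment> \<open>The transfer is applied with the larger cell first: the parent has
    \<open>d\<close>-diameter at most \<open>1 / c2\<close> times that of the child. Using
    \<open>H + 1\<close> keeps the constant below 1.\<close>
  have lower: "1 / (H + 1) * dw \<rho> w \<le> dw \<rho> v" if w: "w \<in> T" and v: "v \<in> chl w" for w v
  proof -
    have vT: "v \<in> T" using v chl_iff[OF w] by blast
    have "dw d w \<le> 1 / c2 * dw d v" using c2(3)[OF w v] c2(1) by (simp add: field_simps)
    moreover have "K w \<inter> K v \<noteq> {}" using cell_child_subset[OF w v] cell_nonempty[OF vT] by blast
    ultimately have "dw \<rho> w \<le> H * dw \<rho> v" using H(2)[OF w vT] by blast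
    then have "dw \<rho> w \<le> (H + 1) * dw \<rho> v" using dw_nonneg[OF \<rho> vT] by (simp add: algebra_simps)
    then show ?thesis using H(1) by (simp add: field_simps)
  qed
  have "(1 / 2 :: real) \<in> {0<..<1}" "1 / (H + 1) \<in> {0<..<1}" using H(1) by auto
  then show ?thesis unfolding exponential_def using upper lower by blast
qed

text \<open>Cells of one \<open>\<rho>\<close>-scale \<open>s\<close> have
  \<open>\<rho>\<close>-diameters between \<open>c2 * s\<close> and \<open>s\<close>. They are thus
  comparable for \<open>\<rho>\<close>, and the control from \<open>\<rho>\<close> to
  \<open>d\<close> makes meeting ones comparable for \<open>d\<close>.\<close>

lemma gentle_transfer:
  assumes d: "d \<in> metrics X" and \<rho>: "\<rho> \<in> metrics X" and c: "qs_control d \<rho>"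
    and wd: "weight (dw d)" and w\<rho>: "weight (dw \<rho>)" and e\<rho>: "expo (dw \<rho>)"
  shows "gentle_wrt T A \<phi> K (dw d) (dw \<rho>)"
proof -
  obtain c2 :: real where c2: "0 < c2" "\<And>s w. w \<in> sc (dw \<rho>) s \<Longrightarrow> s \<le> 1 \<Longrightarrow> c2 * s \<le> dw \<rho> w"
    using exponential_lower[OF e\<rho> w\<rho>] by metis
  have "0 < 1 / c2" using c2 by simp
  from dw_transfer_bound[OF \<rho> d c this] obtain H where H: "0 < H"
    "\<And>v w. v \<in> T \<Longrightarrow> w \<in> T \<Longrightarrow> K v \<inter> K w \<noteq> {} \<Longrightarrow>
      dw \<rho> v \<le> 1 / c2 * dw \<rho> w \<Longrightarrow> dw d v \<le> H * dw d w" by blast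
  have "dw d v \<le> H * dw d w"
    if s: "s \<in> {0<..1}" and w: "w \<in> sc (dw \<rho>) s" and v: "v \<in> sc (dw \<rho>) s" and ne: "K w \<inter> K v \<noteq> {}"
    for s w v
  proof -
    have "dw \<rho> v \<le> s" by (rule scale_le[OF w\<rho> v])
    also have "s \<le> 1 / c2 * dw \<rho> w" using c2(2)[OF w] s c2(1) by (simp add: field_simps)
    finally have "dw \<rho> v \<le> 1 / c2 * dw \<rho> w" .
    then show ?thesis using H(2)[OF scale_in[OF v] scale_in[OF w]] ne by blast
  qed
  then show ?thesis unfolding gentle_wrt_def using w\<rho> weight_pos[OF wd] H(1) by blast
qed

lemma nbhd_subset_ball:
  assumes d: "d \<in> metrics X" and wd: "weight (dw d)" and x: "x \<in> topspace X"
    and y: "y \<in> nbhd (dw d) M x s"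
  shows "y \<in> topspace X" "d x y \<le> (real M + 1) * s"
proof -
  obtain w where w: "\<And>i. i \<le> M \<Longrightarrow> w i \<in> sc (dw d) s" "x \<in> K (w 0)" "y \<in> K (w M)"
    "\<And>i. i < M \<Longrightarrow> K (w i) \<inter> K (w (Suc i)) \<noteq> {}"
    using chain_nbhdE[OF y] by metis
  show "y \<in> topspace X" using w(3) cell_subset scale_in[OF w(1)] by blast
  show "d x y \<le> (real M + 1) * s"
    by (rule chain_dist[OF d scale_in[OF w(1)] scale_le[OF wd w(1)] w(4) w(2) order_refl w(3)])
qed

text \<open>Chains lie in balls by the triangle inequality. For the other inclusion, a
  \<open>d\<close>-chain from \<open>x\<close> to \<open>y\<close> at a scale proportional to
  \<open>d x y\<close> stays within \<open>L * d x y\<close> of \<open>x\<close>; control bounds the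
  \<open>\<rho>\<close>-diameters of its cells, and coarsening gives a \<open>\<rho>\<close>-chain
  with equally many cells.\<close>

lemma M_adapted_transfer:
  assumes d: "d \<in> metrics X" and \<rho>: "\<rho> \<in> metrics X" and c: "qs_control \<rho> d"
    and wd: "weight (dw d)" and w\<rho>: "weight (dw \<rho>)"
    and M: "M_adapted_to X T A \<phi> K M d (dw d)"
  shows "M_adapted_to X T A \<phi> K M \<rho> (dw \<rho>)"
proof -
  obtain \<alpha> where \<alpha>: "0 < \<alpha>" "\<And>x r. x \<in> topspace X \<Longrightarrow> 0 < r \<Longrightarrow>
      Metric_space.mball (topspace X) d x r \<subseteq> nbhd (dw d) M x (\<alpha> * r)"
    using M unfolding M_adapted_to_def by metis
  define L where "L = (real M + 1) * (2 * \<alpha>)"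
  have "0 < L" using \<alpha> by (simp add: L_def)
  from qs_controlE1[OF c this] obtain H where H: "0 < H"
    "\<And>x y z. x \<in> topspace X \<Longrightarrow> y \<in> topspace X \<Longrightarrow> z \<in> topspace X \<Longrightarrow>
      d x z \<le> L * d x y \<Longrightarrow> \<rho> x z \<le> H * \<rho> x y" by blast
  have in1: "nbhd (dw \<rho>) M x (1 / (real M + 2) * r) \<subseteq> Metric_space.mball (topspace X) \<rho> x r"
    if x: "x \<in> topspace X" and r: "0 < r" for x r
  proof
    fix y assume "y \<in> nbhd (dw \<rho>) M x (1 / (real M + 2) * r)"
    from nbhd_subset_ball[OF \<rho> w\<rho> x this]
    have y: "y \<in> topspace X" "\<rho> x y \<le> (real M + 1) * (1 / (real M + 2) * r)" by auto
    have "(real M + 1) * (1 / (real M + 2) * r) < r" using r by (simp add: field_simps)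
    then show "y \<in> Metric_space.mball (topspace X) \<rho> x r"
      using x y Metric_space.in_mball[OF metric_space[OF \<rho>]] by auto
  qed
  have in2: "Metric_space.mball (topspace X) \<rho> x r \<subseteq> nbhd (dw \<rho>) M x (2 * H * r)"
    if x: "x \<in> topspace X" and r: "0 < r" for x r
  proof
    fix y assume "y \<in> Metric_space.mball (topspace X) \<rho> x r"
    then have y: "y \<in> topspace X" "\<rho> x y < r"
      using Metric_space.in_mball[OF metric_space[OF \<rho>]] by auto
    have s: "0 < 2 * H * r" using H r by simp
    show "y \<in> nbhd (dw \<rho>) M x (2 * H * r)"
    \<comment> \<open>The ball around \<open>x\<close> is taken with radius \<open>2 * d x y\<close>
      so that the open ball contains \<open>y\<close>; this needs distinct points. For
      \<open>x = y\<close> a constant chain suffices.\<close>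
    proof (cases "x = y")
      case True
      have "x \<in> K \<phi>" using cell_root x by simp
      from cell_ray_exists[OF root this] obtain \<omega> where o: "cell_ray x \<omega>" "\<omega> 0 = \<phi>" by blast
      from cell_ray_scale_root[OF w\<rho> o(1) s o(2)] obtain n where n: "\<omega> n \<in> sc (dw \<rho>) (2 * H * r)"
        by blast
      have "x \<in> K (\<omega> n)" using o by (simp add: cell_ray_def)
      then show ?thesis using n True by (intro chain_nbhdI[of _ "\<lambda>_. \<omega> n"]) auto
    next
      case False
      then have D: "0 < d x y" using dist_zero[OF d x y(1)] dist_nonneg[OF d, of x y] by simp
      then have "y \<in> Metric_space.mball (topspace X) d x (2 * d x y)"
        using x y Metric_space.in_mball[OF metric_space[OF d]] by auto
      then have "y \<in> nbhd (dw d) M x (\<alpha> * (2 * d x y))" using \<alpha>(2)[OF x, of "2 * d x y"] D by auto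
      from chain_nbhdE[OF this] obtain w where w: "\<And>i. i \<le> M \<Longrightarrow> w i \<in> sc (dw d) (\<alpha> * (2 * d x y))"
        "x \<in> K (w 0)" "y \<in> K (w M)"
        "\<And>i. i < M \<Longrightarrow> K (w i) \<inter> K (w (Suc i)) \<noteq> {}" by metis
      have T: "w i \<in> T" if "i \<le> M" for i using scale_in[OF w(1)[OF that]] .
      show ?thesis
      proof (rule chain_nbhd_of_small[OF w\<rho> s T _ w(2-4)])
        fix i assume i: "i \<le> M"
        have "\<rho> x z \<le> H * r" if z: "z \<in> K (w i)" for z
        proof -
          have zX: "z \<in> topspace X" using z cell_subset[OF T[OF i]] by blast
          have "d x z \<le> (real i + 1) * (\<alpha> * (2 * d x y))"
            by (rule chain_dist[OF d T scale_le[OF wd w(1)] w(4) w(2) i z])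
          also have "\<dots> \<le> (real M + 1) * (\<alpha> * (2 * d x y))"
            using i \<alpha>(1) D by (intro mult_right_mono) auto
          finally have "d x z \<le> L * d x y" by (simp only: L_def mult_ac)
          then have "\<rho> x z \<le> H * \<rho> x y" using H(2)[OF x y(1) zX] by blast
          also have "\<dots> \<le> H * r" using y(2) H(1) by simp
          finally show ?thesis .
        qed
        then have "mdiam \<rho> (K (w i)) \<le> 2 * (H * r)"
          using mdiam_le_radius[OF \<rho> cell_nonempty[OF T[OF i]] cell_subset[OF T[OF i]] x] by blast
        then show "dw \<rho> (w i) \<le> 2 * H * r" by (simp add: diam_weight_def)
      qed
    qed
  qed
  show ?thesis
    unfolding M_adapted_to_def
  proof (intro exI conjI ballI allI impI)
    show "0 < 1 / (real M + 2)" "0 < 2 * H" using H(1) by auto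
  qed (use in1 in2 in auto)
qed

section \<open>Gentle adapted metrics are quasisymmetric\<close>

text \<open>Enlarging the constant to at least 1 makes its powers increasing, as required when
  factors accumulate along a chain.\<close>

lemma gentle_const:
  assumes g: "gentle_wrt T A \<phi> K b a"
  obtains c where "1 \<le> c" "\<And>s u v. 0 < s \<Longrightarrow> u \<in> sc a s \<Longrightarrow> v \<in> sc a s \<Longrightarrow>
    K u \<inter> K v \<noteq> {} \<Longrightarrow> b v \<le> c * b u"
proof -
  have pos: "\<forall>w\<in>T. 0 < b w" using g unfolding gentle_wrt_def by blast
  have "\<exists>c>0. \<forall>s\<in>{0<..1}. \<forall>w\<in>sc a s. \<forall>v\<in>sc a s. K w \<inter> K v \<noteq> {} \<longrightarrow> b v \<le> c * b w"
    using g unfolding gentle_wrt_def by blast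
  then obtain c where c: "\<forall>s\<in>{0<..1}. \<forall>w\<in>sc a s. \<forall>v\<in>sc a s. K w \<inter> K v \<noteq> {} \<longrightarrow> b v \<le> c * b w"
    by blast
  have "b v \<le> max c 1 * b u"
    if s: "0 < s" and u: "u \<in> sc a s" and v: "v \<in> sc a s" and ne: "K u \<inter> K v \<noteq> {}" for s u v
  proof -
    have "u \<in> sc a (min s 1)" "v \<in> sc a (min s 1)" using u v by (simp_all add: scale_min)
    moreover have "min s 1 \<in> {0<..1}" using s by auto
    ultimately have "b v \<le> c * b u" using c ne by blast
    also have "\<dots> \<le> max c 1 * b u"
      by (intro mult_right_mono) (use pos scale_in[OF u] in \<open>auto simp: less_imp_le\<close>)
    finally show ?thesis .
  qed
  then show thesis by (intro that[of "max c 1"]) auto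
qed

text \<open>A cell of a \<open>b\<close>-small chain that were not \<open>a\<close>-small would contain a cell of the \<open>a\<close>-scale
  \<open>s\<close>; by gentleness this cell would be too large for \<open>b\<close>.\<close>

lemma small_chain_cells:
  assumes a: "weight a" and b: "weight b"
    and c: "1 \<le> c" "\<And>u v. u \<in> sc a s \<Longrightarrow> v \<in> sc a s \<Longrightarrow> K u \<inter> K v \<noteq> {} \<Longrightarrow> b v \<le> c * b u"
    and s: "0 < s" and w: "w \<in> sc a s" "x \<in> K w"
    and v: "\<And>i. i \<le> M \<Longrightarrow> v i \<in> T" "\<And>i. i \<le> M \<Longrightarrow> b (v i) \<le> \<beta>" "x \<in> K (v 0)"
    and meet: "\<And>i. i < M \<Longrightarrow> K (v i) \<inter> K (v (Suc i)) \<noteq> {}"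
    and \<beta>: "c ^ (M + 1) * \<beta> < b w" "0 \<le> \<beta>"
    and i: "i \<le> M"
  shows "a (v i) \<le> s"
proof -
  \<comment> \<open>The invariant carried along the chain is a scale ancestor \<open>u'\<close> of
    the current cell whose \<open>b\<close>-weight is still comparable to that of \<open>w\<close>.
    Passing through a shared point \<open>p\<close> costs one factor \<open>c\<close>.\<close>
  have step: "a v' \<le> s \<and> (\<exists>u'\<in>sc a s. v' \<in> desc u' \<and> b w \<le> c ^ Suc k * b u')"
    if u: "u \<in> sc a s" "p \<in> K u" "p \<in> K v'" and v': "v' \<in> T" "b v' \<le> \<beta>"
      and k: "b w \<le> c ^ k * b u" "k \<le> M" for u p v' k
  proof -
    have *: "b w \<le> c ^ Suc k * b u'" if "u' \<in> sc a s" "p \<in> K u'" for u'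
    proof -
      have "b u \<le> c * b u'" using c(2)[OF that(1) u(1)] that u by blast
      then have "c ^ k * b u \<le> c ^ k * (c * b u')" using c(1) by (intro mult_left_mono) auto
      then show ?thesis using k by (simp add: mult_ac)
    qed
    have le: "a v' \<le> s"
    proof (rule ccontr)
      assume "\<not> ?thesis"
      then have "s < a v'" by simp
      from scale_below[OF a v'(1) u(3) s this] obtain u' where
        u': "u' \<in> sc a s" "u' \<in> desc v'" "p \<in> K u'" by blast
      have "b w \<le> c ^ Suc k * b u'" using *[OF u'(1,3)] .
      also have "\<dots> \<le> c ^ Suc k * \<beta>"
        using weight_desc[OF u'(2) v'(1) b] v'(2) c(1) by (intro mult_left_mono) auto
      also have "\<dots> \<le> c ^ (M + 1) * \<beta>"
        using c(1) k(2) \<beta>(2) by (intro mult_right_mono power_increasing) auto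
      finally show False using \<beta>(1) by simp
    qed
    from scale_above[OF a v'(1) s this] obtain u' where u': "u' \<in> sc a s" "v' \<in> desc u'" by blast
    then have "p \<in> K u'" using cell_mono[OF u'(2) scale_in[OF u'(1)]] u(3) by blast
    then show ?thesis using le u' * by blast
  qed
  have "a (v i) \<le> s \<and> (\<exists>u\<in>sc a s. v i \<in> desc u \<and> b w \<le> c ^ Suc i * b u)"
    using i
  proof (induction i)
    case 0
    then show ?case using step[OF w v(3) v(1) v(2), of 0] by simp
  next
    case (Suc i)
    then obtain u where u: "u \<in> sc a s" "v i \<in> desc u" "b w \<le> c ^ Suc i * b u" by auto
    obtain p where p: "p \<in> K (v i)" "p \<in> K (v (Suc i))" using meet[of i] Suc by auto
    have "p \<in> K u" using cell_mono[OF u(2) scale_in[OF u(1)]] p by blast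
    then show ?case using step[OF u(1) _ p(2) v(1) v(2) u(3)] Suc by simp
  qed
  then show ?thesis by simp
qed

text \<open>Starting from \<open>u\<close>, which meets the first cell in \<open>x\<close>, each
  cell of the chain costs one factor \<open>c\<close>. The chain has \<open>M + 1\<close> cells,
  which explains both the power and the linear factor.\<close>

lemma chain_dist_gentle:
  assumes d: "d \<in> metrics X"
    and c: "1 \<le> c" "\<And>u v. u \<in> sc a s \<Longrightarrow> v \<in> sc a s \<Longrightarrow> K u \<inter> K v \<noteq> {} \<Longrightarrow> dw d v \<le> c * dw d u"
    and u: "u \<in> sc a s" "x \<in> K u" and z: "z \<in> nbhd a M x s"
  shows "d x z \<le> (real M + 1) * c ^ (M + 1) * dw d u"
proof -
  from chain_nbhdE[OF z] obtain w where w: "\<And>i. i \<le> M \<Longrightarrow> w i \<in> sc a s" "x \<in> K (w 0)" "z \<in> K (w M)"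
    "\<And>i. i < M \<Longrightarrow> K (w i) \<inter> K (w (Suc i)) \<noteq> {}" by metis
  have T: "w i \<in> T" if "i \<le> M" for i using scale_in[OF w(1)[OF that]] .
  have *: "dw d (w i) \<le> c ^ Suc i * dw d u" if "i \<le> M" for i
    using that
  proof (induction i)
    case 0
    have "K u \<inter> K (w 0) \<noteq> {}" using u w(2) by blast
    then show ?case using c(2)[OF u(1) w(1)[OF 0]] by simp
  next
    case (Suc i)
    have "dw d (w (Suc i)) \<le> c * dw d (w i)"
      using c(2)[OF w(1) w(1) w(4), of i] Suc by simp
    also have "\<dots> \<le> c * (c ^ Suc i * dw d u)" using Suc c(1) by (intro mult_left_mono) auto
    finally show ?case by simp
  qed
  have le: "dw d (w i) \<le> c ^ (M + 1) * dw d u" if i: "i \<le> M" for i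
  proof -
    have "c ^ Suc i * dw d u \<le> c ^ (M + 1) * dw d u"
      using c(1) i dw_nonneg[OF d scale_in[OF u(1)]] by (intro mult_right_mono power_increasing) auto
    then show ?thesis using *[OF i] by simp
  qed
  have "d x z \<le> (real M + 1) * (c ^ (M + 1) * dw d u)"
    by (rule chain_dist[OF d T le w(4) w(2) order_refl w(3)])
  then show ?thesis by (simp add: mult_ac)
qed

text \<open>Were \<open>y\<close> closer to \<open>x\<close>, adaptedness of \<open>d\<close> would
  join them by cells of \<open>d\<close>-diameter at most \<open>\<alpha> * r\<close>. The constant
  makes \<open>c ^ (M + 1) * (\<alpha> * r)\<close> half of \<open>dw d w\<close>, so these cells
  also have \<open>\<rho>\<close>-diameter at most \<open>s\<close>, which forces
  \<open>\<rho> x y\<close> to be at most \<open>(M + 1) * s\<close>.\<close>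

lemma dist_ge_gentle:
  assumes d: "d \<in> metrics X" and \<rho>: "\<rho> \<in> metrics X"
    and wd: "weight (dw d)" and w\<rho>: "weight (dw \<rho>)"
    and c: "1 \<le> c" "\<And>u v. u \<in> sc (dw \<rho>) s \<Longrightarrow> v \<in> sc (dw \<rho>) s \<Longrightarrow> K u \<inter> K v \<noteq> {} \<Longrightarrow>
      dw d v \<le> c * dw d u"
    and \<alpha>: "0 < \<alpha>" "\<And>r. 0 < r \<Longrightarrow>
      Metric_space.mball (topspace X) d x r \<subseteq> nbhd (dw d) M x (\<alpha> * r)"
    and s: "0 < s" and w: "w \<in> sc (dw \<rho>) s" "x \<in> K w"
    and y: "y \<in> topspace X" "(real M + 1) * s < \<rho> x y"
  shows "dw d w / (2 * \<alpha> * c ^ (M + 1)) \<le> d x y"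
proof (rule ccontr)
  define r where "r = dw d w / (2 * \<alpha> * c ^ (M + 1))"
  assume "\<not> ?thesis"
  then have less: "d x y < r" by (simp add: r_def)
  have x: "x \<in> topspace X" using w cell_subset scale_in by blast
  have pos: "0 < dw d w" using weight_pos[OF wd scale_in[OF w(1)]] .
  have cp: "0 < c ^ (M + 1)" using c(1) by simp
  have r: "0 < r" using pos \<alpha>(1) cp by (simp add: r_def)
  have "y \<in> Metric_space.mball (topspace X) d x r"
    using x y less Metric_space.in_mball[OF metric_space[OF d]] by auto
  then have "y \<in> nbhd (dw d) M x (\<alpha> * r)" using \<alpha>(2)[OF r] by blast
  from chain_nbhdE[OF this] obtain v where
    v: "\<And>i. i \<le> M \<Longrightarrow> v i \<in> sc (dw d) (\<alpha> * r)" "x \<in> K (v 0)" "y \<in> K (v M)"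
    "\<And>i. i < M \<Longrightarrow> K (v i) \<inter> K (v (Suc i)) \<noteq> {}" by metis
  have T: "v i \<in> T" if "i \<le> M" for i using scale_in[OF v(1)[OF that]] .
  have "c ^ (M + 1) * (\<alpha> * r) = dw d w / 2" using \<alpha>(1) c(1) by (simp add: r_def)
  then have \<beta>: "c ^ (M + 1) * (\<alpha> * r) < dw d w" "0 \<le> \<alpha> * r" using pos r \<alpha>(1) by simp_all
  have "dw \<rho> (v i) \<le> s" if "i \<le> M" for i
    by (rule small_chain_cells[OF w\<rho> wd c s w T scale_le[OF wd v(1)] v(2,4) \<beta> that])
  from chain_dist[OF \<rho> T this v(4,2) order_refl v(3)] have "\<rho> x y \<le> (real M + 1) * s"
    by blast
  then show False using y by simp
qed

text \<open>Two members of a descending sequence are comparable in the tree, but in an order not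
  known in advance; the sum of powers handles \<open>i \<le> j\<close> and \<open>j < i\<close> at
  once.\<close>

lemma weight_ratio_compare:
  assumes a: "weight a" "expo a" and b: "weight b" "expo b"
  obtains C p q :: real where "0 < C" "0 < p" "0 < q"
    "\<And>x \<omega> i j. cell_ray x \<omega> \<Longrightarrow>
      b (\<omega> j) \<le> C * b (\<omega> i) * ((a (\<omega> j) / a (\<omega> i)) powr p + (a (\<omega> j) / a (\<omega> i)) powr q)"
proof -
  from exponential_compare[OF a b] obtain C p :: real where C: "0 < C" "0 < p"
    "\<And>w v. w \<in> T \<Longrightarrow> v \<in> desc w \<Longrightarrow> b v \<le> C * b w * (a v / a w) powr p" by metis
  from exponential_compare_reverse[OF a b] obtain D q :: real where D: "0 < D" "0 < q"
    "\<And>w v. w \<in> T \<Longrightarrow> v \<in> desc w \<Longrightarrow> b w \<le> D * b v * (a w / a v) powr q" by metis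
  have "b (\<omega> j) \<le> (C + D) * b (\<omega> i) * ((a (\<omega> j) / a (\<omega> i)) powr p + (a (\<omega> j) / a (\<omega> i)) powr q)"
    if r: "cell_ray x \<omega>" for x \<omega> i j
  proof -
    have T: "\<omega> i \<in> T" "\<omega> j \<in> T" using r by (simp_all add: cell_ray_def)
    let ?P = "(a (\<omega> j) / a (\<omega> i)) powr p" and ?Q = "(a (\<omega> j) / a (\<omega> i)) powr q"
    have bi: "0 \<le> b (\<omega> i)" using weight_pos[OF b(1) T(1)] by simp
    have PQ: "0 \<le> ?P" "0 \<le> ?Q" by simp_all
    show ?thesis
    proof (cases "i \<le> j")
      case True
      then have "\<omega> j \<in> desc (\<omega> i)" using cell_ray_desc(1)[OF r, of i "j - i"] by simp
      then have "b (\<omega> j) \<le> C * b (\<omega> i) * ?P" by (rule C(3)[OF T(1)])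
      also have "\<dots> \<le> (C + D) * b (\<omega> i) * (?P + ?Q)"
        using C(1) D(1) bi PQ by (intro mult_mono) auto
      finally show ?thesis .
    next
      case False
      then have "\<omega> i \<in> desc (\<omega> j)" using cell_ray_desc(1)[OF r, of j "i - j"] by simp
      then have "b (\<omega> j) \<le> D * b (\<omega> i) * ?Q" by (rule D(3)[OF T(2)])
      also have "\<dots> \<le> (C + D) * b (\<omega> i) * (?P + ?Q)"
        using C(1) D(1) bi PQ by (intro mult_mono) auto
      finally show ?thesis .
    qed
  qed
  then show thesis using C(1,2) D(1,2) by (intro that[of "C + D" p q]) auto
qed

lemma quasisymmetric_if_gentle:
  assumes d: "d \<in> metrics_Ae X T A \<phi> K" and \<rho>: "\<rho> \<in> metrics_Ae X T A \<phi> K"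
    and g: "gentle_wrt T A \<phi> K (dw d) (dw \<rho>)"
  shows "quasisymmetric_to X d \<rho>"
proof -
  have md: "d \<in> metrics X" "weight (dw d)" "expo (dw d)" and m\<rho>: "\<rho> \<in> metrics X" "weight (dw \<rho>)" "expo (dw \<rho>)"
    using d \<rho> by (simp_all add: metrics_Ae_def)
  obtain M \<alpha> where \<alpha>: "0 < \<alpha>" "\<And>x r. x \<in> topspace X \<Longrightarrow> 0 < r \<Longrightarrow>
      Metric_space.mball (topspace X) d x r \<subseteq> nbhd (dw d) M x (\<alpha> * r)"
    using d unfolding metrics_Ae_def adapted_def M_adapted_to_def by blast
  obtain N \<beta> where \<beta>: "0 < \<beta>" "\<And>x r. x \<in> topspace X \<Longrightarrow> 0 < r \<Longrightarrow>
      Metric_space.mball (topspace X) \<rho> x r \<subseteq> nbhd (dw \<rho>) N x (\<beta> * r)"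
    using \<rho> unfolding metrics_Ae_def adapted_def M_adapted_to_def by blast
  from gentle_const[OF g] obtain c where c: "1 \<le> c"
    "\<And>s u v. 0 < s \<Longrightarrow> u \<in> sc (dw \<rho>) s \<Longrightarrow> v \<in> sc (dw \<rho>) s \<Longrightarrow>
      K u \<inter> K v \<noteq> {} \<Longrightarrow> dw d v \<le> c * dw d u" by metis
  from exponential_lower[OF m\<rho>(3,2)] obtain e :: real where e: "0 < e"
    "\<And>s w. w \<in> sc (dw \<rho>) s \<Longrightarrow> s \<le> 1 \<Longrightarrow> e * s \<le> dw \<rho> w" by metis
  from weight_ratio_compare[OF m\<rho>(2,3) md(2,3)] obtain C p q :: real where
    C: "0 < C" "0 < p" "0 < q" "\<And>x \<omega> i j. cell_ray x \<omega> \<Longrightarrow>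
      dw d (\<omega> j) \<le> C * dw d (\<omega> i) *
        ((dw \<rho> (\<omega> j) / dw \<rho> (\<omega> i)) powr p + (dw \<rho> (\<omega> j) / dw \<rho> (\<omega> i)) powr q)" by metis
  \<comment> \<open>With \<open>s\<close> and \<open>S\<close> chosen below,
    \<open>\<kappa> * t\<close> equals \<open>S / (e * s)\<close>, the bound for the quotient of the
    two \<open>\<rho>\<close>-weights.\<close>
  define \<kappa> where "\<kappa> = \<beta> * (real M + 2) / e"
  define B where "B = (real N + 1) * c ^ (N + 1)"
  define G where "G = 2 * \<alpha> * c ^ (M + 1)"
  \<comment> \<open>\<open>B\<close> comes from the upper bound for \<open>d x z\<close>,
    \<open>G\<close> from the lower bound for \<open>d x y\<close>, and \<open>C\<close> from the
    ratio estimate. The factor 2 turns the resulting inequality into a strict one.\<close>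
  define F where "F = 2 * (B * C * G * (\<kappa> powr p + \<kappa> powr q))"
  have pos: "0 < \<kappa>" "0 < B" "0 < G" using \<alpha>(1) \<beta>(1) c(1) e(1) by (simp_all add: \<kappa>_def B_def G_def)
  have F: "0 < F" using pos C(1) by (simp add: F_def add_pos_pos)
  have "d x z < F * (t powr p + t powr q) * d x y"
    if t: "0 < t" and x: "x \<in> topspace X" and y: "y \<in> topspace X" and z: "z \<in> topspace X"
      and less: "\<rho> x z < t * \<rho> x y" for t x y z
  proof -
    have R: "0 < \<rho> x y" using less t dist_nonneg[OF m\<rho>(1), of x z] dist_nonneg[OF m\<rho>(1), of x y]
      by (metis mult_zero_right order_le_less not_less)
    have R1: "\<rho> x y \<le> 1" using dw_upper[OF m\<rho>(1) root, of x y] dw_root[OF m\<rho>(1)] cell_root x y by simp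
    \<comment> \<open>The denominator exceeds \<open>M + 1\<close>, so \<open>M + 1\<close> cells of
      this scale cannot join \<open>x\<close> to \<open>y\<close>. Diameter 1 of the space gives
      \<open>s \<le> 1\<close>, which the lower weight bound requires.\<close>
    define s where "s = \<rho> x y / (real M + 2)"
    define S where "S = \<beta> * (t * \<rho> x y)"
    have s: "0 < s" "s \<le> 1" "(real M + 1) * s < \<rho> x y" using R R1 by (simp_all add: s_def field_simps)
    have S: "0 < S" using \<beta>(1) t R by (simp add: S_def)
    have "x \<in> K \<phi>" using cell_root x by simp
    from cell_ray_exists[OF root this] obtain \<omega> where r: "cell_ray x \<omega>" "\<omega> 0 = \<phi>" by metis
    have T: "\<omega> i \<in> T" "x \<in> K (\<omega> i)" for i using r by (simp_all add: cell_ray_def)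
    obtain i where i: "\<omega> i \<in> sc (dw \<rho>) s" using cell_ray_scale_root[OF m\<rho>(2) r(1) s(1) r(2)] by metis
    obtain j where j: "\<omega> j \<in> sc (dw \<rho>) S" using cell_ray_scale_root[OF m\<rho>(2) r(1) S r(2)] by metis
    have "z \<in> Metric_space.mball (topspace X) \<rho> x (t * \<rho> x y)"
      using x z less Metric_space.in_mball[OF metric_space[OF m\<rho>(1)]] by auto
    then have zN: "z \<in> nbhd (dw \<rho>) N x S" using \<beta>(2)[OF x, of "t * \<rho> x y"] t R unfolding S_def by auto
    have up: "d x z \<le> B * dw d (\<omega> j)"
      unfolding B_def by (rule chain_dist_gentle[OF md(1) c(1) c(2)[OF S] j T(2) zN])
    have low: "dw d (\<omega> i) / G \<le> d x y"
      unfolding G_def by (rule dist_ge_gentle[OF md(1) m\<rho>(1) md(2) m\<rho>(2) c(1) c(2)[OF s(1)] \<alpha>(1) \<alpha>(2)[OF x]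
        s(1) i T(2) y s(3)])
    have apos: "0 < dw \<rho> (\<omega> i)" "0 < dw \<rho> (\<omega> j)" "0 < dw d (\<omega> i)"
      using weight_pos[OF m\<rho>(2) T(1)] weight_pos[OF md(2) T(1)] by auto
    have D: "0 < d x y" using low apos(3) pos(3) by (meson divide_pos_pos less_le_trans)
    have "dw \<rho> (\<omega> j) / dw \<rho> (\<omega> i) \<le> S / (e * s)"
      using scale_le[OF m\<rho>(2) j] e(2)[OF i s(2)] e(1) s(1) S by (intro frac_le) auto
    also have "S / (e * s) = \<kappa> * t" using R e(1) by (simp add: S_def s_def \<kappa>_def field_simps)
    finally have ratio: "dw \<rho> (\<omega> j) / dw \<rho> (\<omega> i) \<le> \<kappa> * t" .
    have pw: "(dw \<rho> (\<omega> j) / dw \<rho> (\<omega> i)) powr k \<le> \<kappa> powr k * t powr k" if "0 < k" for k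
      using powr_mono2[OF less_imp_le[OF that] _ ratio] apos by (simp add: powr_mult)
    have nn: "0 \<le> \<kappa> powr p * t powr q" "0 \<le> \<kappa> powr q * t powr p" by simp_all
    have "(dw \<rho> (\<omega> j) / dw \<rho> (\<omega> i)) powr p + (dw \<rho> (\<omega> j) / dw \<rho> (\<omega> i)) powr q
        \<le> (\<kappa> powr p + \<kappa> powr q) * (t powr p + t powr q)"
      using pw[OF C(2)] pw[OF C(3)] nn unfolding distrib_left distrib_right by linarith
    then have "C * dw d (\<omega> i) * ((dw \<rho> (\<omega> j) / dw \<rho> (\<omega> i)) powr p + (dw \<rho> (\<omega> j) / dw \<rho> (\<omega> i)) powr q)
        \<le> C * dw d (\<omega> i) * ((\<kappa> powr p + \<kappa> powr q) * (t powr p + t powr q))"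
      using C(1) apos(3) by (intro mult_left_mono) auto
    with C(4)[OF r(1), of j i]
    have "dw d (\<omega> j) \<le> C * dw d (\<omega> i) * ((\<kappa> powr p + \<kappa> powr q) * (t powr p + t powr q))" by linarith
    also have "\<dots> \<le> C * (G * d x y) * ((\<kappa> powr p + \<kappa> powr q) * (t powr p + t powr q))"
      using low pos(3) C(1) by (intro mult_right_mono mult_left_mono) (auto simp: field_simps)
    finally have "B * dw d (\<omega> j) \<le> B * (C * (G * d x y) * ((\<kappa> powr p + \<kappa> powr q) * (t powr p + t powr q)))"
      using pos(2) by (intro mult_left_mono) auto
    also have "\<dots> = F * (t powr p + t powr q) * d x y / 2" by (simp add: F_def)
    also have "\<dots> < F * (t powr p + t powr q) * d x y"
    proof -
      have "0 < F * (t powr p + t powr q) * d x y" using F D t by (simp add: add_pos_pos)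
      then show ?thesis by linarith
    qed
    finally show ?thesis using up by simp
  qed
  then show ?thesis
    unfolding quasisymmetric_to_def using homeomorphic_map_powr_sum[OF F C(2,3)]
    by (intro exI[of _ "\<lambda>t. F * (t powr p + t powr q)"]) auto
qed

end

theorem theorem13p6:
  fixes T :: "'t set" and A :: "'t \<Rightarrow> 't \<Rightarrow> nat" and \<phi> :: 't
    and X :: "'x topology" and K :: "'t \<Rightarrow> 'x set"
    and d \<rho> :: "'x \<Rightarrow> 'x \<Rightarrow> real"
  assumes "countable T" and "infinite T"
    and "locally_finite_tree T A" and "\<phi> \<in> T"
    and "compact_space X" and "metrizable_space X"
    and "\<forall>x\<in>topspace X. \<not> openin X {x}"
    and "partition_of X T A \<phi> K"
    and "d \<in> metrics_Ae X T A \<phi> K"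
    and "\<rho> \<in> metrics X"
  shows "(quasisymmetric_to X d \<rho> \<longleftrightarrow>
            \<rho> \<in> metrics_Ae X T A \<phi> K \<and>
            gentle_wrt T A \<phi> K (diam_weight K d) (diam_weight K \<rho>)) \<and>
         (\<forall>M. M_adapted_to X T A \<phi> K M d (diam_weight K d) \<and> quasisymmetric_to X d \<rho> \<longrightarrow>
            M_adapted_to X T A \<phi> K M \<rho> (diam_weight K \<rho>))"
proof -
  interpret compact_partition T A \<phi> X K
    by unfold_locales (use assms in blast)+
  have d: "d \<in> metrics X" "weight (dw d)" "expo (dw d)" and ad: "adapted X T A \<phi> K d"
    using \<open>d \<in> metrics_Ae X T A \<phi> K\<close> by (simp_all add: metrics_Ae_def)
  note \<rho> = \<open>\<rho> \<in> metrics X\<close>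
  \<comment> \<open>The hypothesis yields the first comparison, used for gentleness; symmetry yields
    the second, which carries the other properties from \<open>d\<close> to
    \<open>\<rho>\<close>.\<close>
  have control: "qs_control d \<rho>" "qs_control \<rho> d" if "quasisymmetric_to X d \<rho>"
    using quasisymmetric_imp_control[OF \<rho> d(1) that] qs_control_sym[OF \<rho> d(1)] by blast+
  have w\<rho>: "weight (dw \<rho>)" if "quasisymmetric_to X d \<rho>"
    by (rule weight_transfer[OF d(1) \<rho> control(2)[OF that] d(2)])
  have adapt: "M_adapted_to X T A \<phi> K M \<rho> (dw \<rho>)"
    if "M_adapted_to X T A \<phi> K M d (dw d)" "quasisymmetric_to X d \<rho>" for M
    by (rule M_adapted_transfer[OF d(1) \<rho> control(2)[OF that(2)] d(2) w\<rho>[OF that(2)] that(1)])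
  have forward: "\<rho> \<in> metrics_Ae X T A \<phi> K \<and> gentle_wrt T A \<phi> K (dw d) (dw \<rho>)"
    if qs: "quasisymmetric_to X d \<rho>"
  proof -
    have e: "expo (dw \<rho>)" by (rule expo_transfer[OF d(1) \<rho> control(2)[OF qs] d(2,3)])
    moreover have "adapted X T A \<phi> K \<rho>" using ad adapt qs unfolding adapted_def by blast
    ultimately show ?thesis
      using \<rho> w\<rho>[OF qs] gentle_transfer[OF d(1) \<rho> control(1)[OF qs] d(2) w\<rho>[OF qs] e]
      by (simp add: metrics_Ae_def)
  qed
  show ?thesis
    using forward adapt quasisymmetric_if_gentle[OF \<open>d \<in> metrics_Ae X T A \<phi> K\<close>] by blast
qed

end
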